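(* Let $B=\{z\in\mathbb{C}^2:\|z\|<1\}$ be the open unit ball in $\mathbb{C}^2$ (Euclidean norm) and $\partial B$ its boundary. There exists a compact set $X\subset\partial B\subset\mathbb{C}^2$ such that the origin is in $\widehat X\setminus X$ and the origin is a one-point Gleason part for $P(X)$.
   Context: For a compact set $X\subset\mathbb{C}^N$, the polynomial hull of $X$ is $\widehat X=\{z\in\mathbb{C}^N: |p(z)|\le \max_{x\in X}|p(x)| \text{ for all polynomials } p\}$, where polynomials are holomorphic polynomials in the complex coordinates $z_1,\ldots,z_N$. $P(X)$ denotes the closure, in the algebra $C(X)$ of continuous complex-valued functions on $X$ with the supremum norm, of (the restrictions to $X$ of) the polynomials in $z_1,\ldots,z_N$. The maximal ideal space of $P(X)$ is identified with $\widehat X$: a point $z\in\widehat X$ corresponds to the unique continuous multiplicative linear functional $\varphi_z$ on $P(X)$ with $\varphi_z(p)=p(z)$ for every polynomial $p$. The Gleason parts for $P(X)$ are the equivalence classes in $\widehat X$ under the relation $z\sim w$ iff $\|\varphi_z-\varphi_w\|<2$ in the norm of the dual space $P(X)^*$ (this is an equivalence relation). A point $x_0\in\widehat X$ is a one-point Gleason part for $P(X)$ if $\{x_0\}$ is a Gleason part, i.e., $\|\varphi_{x_0}-\varphi_w\|=2$ for every $w\in\widehat X\setminus\{x_0\}$. *)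

theory Defs
  imports "HOL-Analysis.Analysis"
begin

section \<open>Polynomials and the polynomial hull\<close>

text \<open>The multi-indices are the functions \<open>\<alpha> :: 'n \<Rightarrow> nat\<close>.\<close>

definition holo_poly :: "((complex^'n) \<Rightarrow> complex) \<Rightarrow> bool" where
  "holo_poly p \<longleftrightarrow>
     (\<exists>(A :: ('n \<Rightarrow> nat) set) c.
        finite A \<and> p = (\<lambda>z. \<Sum>\<alpha>\<in>A. c \<alpha> * (\<Prod>i\<in>UNIV. (z $ i) ^ \<alpha> i)))"

text \<open>For nonempty compact \<open>X\<close> and continuous \<open>f\<close> the supremum is attained, so it is the
  maximum of the modulus.\<close>

definition sup_norm :: "'a set \<Rightarrow> ('a \<Rightarrow> complex) \<Rightarrow> real" where
  "sup_norm X f = (SUP x\<in>X. cmod (f x))"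

text \<open>For \<open>X = {}\<close> the value of \<open>sup_norm\<close> is unspecified, but it is one fixed number, so the
  constant polynomials show that the hull of the empty set is empty.\<close>

definition poly_hull :: "(complex^'n) set \<Rightarrow> (complex^'n) set" where
  "poly_hull X = {z. \<forall>p. holo_poly p \<longrightarrow> cmod (p z) \<le> sup_norm X p}"

section \<open>The uniform algebra P(X)\<close>

text \<open>\<open>C(X)\<close> is the library's metric space of bounded continuous functions on \<open>X\<close>. Its elements
  are extensional, that is, equal to \<open>undefined\<close> off \<open>X\<close>, so that functions on the subset \<open>X\<close>
  are represented uniquely, and restrictions to \<open>X\<close> are written with \<open>restrict\<close>.\<close>

definition C_space :: "(complex^'n) set \<Rightarrow> ((complex^'n) \<Rightarrow> complex) metric" where
  "C_space X = cfunspace (top_of_set X) euclidean_metric"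

definition P_alg :: "(complex^'n) set \<Rightarrow> ((complex^'n) \<Rightarrow> complex) set" where
  "P_alg X = mtopology_of (C_space X) closure_of {restrict p X | p. holo_poly p}"

definition mult_functional ::
    "(complex^'n) set \<Rightarrow> (((complex^'n) \<Rightarrow> complex) \<Rightarrow> complex) \<Rightarrow> bool" where
  "mult_functional X \<phi> \<longleftrightarrow>
     \<phi> \<in> extensional (P_alg X) \<and>
     (\<forall>f\<in>P_alg X. \<forall>g\<in>P_alg X. \<phi> (\<lambda>x\<in>X. f x + g x) = \<phi> f + \<phi> g) \<and>
     (\<forall>a. \<forall>f\<in>P_alg X. \<phi> (\<lambda>x\<in>X. a * f x) = a * \<phi> f) \<and>
     (\<forall>f\<in>P_alg X. \<forall>g\<in>P_alg X. \<phi> (\<lambda>x\<in>X. f x * g x) = \<phi> f * \<phi> g) \<and>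
     continuous_map (subtopology (mtopology_of (C_space X)) (P_alg X)) euclidean \<phi>"

text \<open>The functional \<open>\<phi>\<^sub>z\<close> attached to a point \<open>z\<close> of the hull. Existence and uniqueness are
  proved in \<open>eval_functional_ex1\<close> below.\<close>

definition eval_functional ::
    "(complex^'n) set \<Rightarrow> complex^'n \<Rightarrow> ((complex^'n) \<Rightarrow> complex) \<Rightarrow> complex" where
  "eval_functional X z =
     (THE \<phi>. mult_functional X \<phi> \<and> (\<forall>p. holo_poly p \<longrightarrow> \<phi> (restrict p X) = p z))"

section \<open>Gleason parts\<close>

text \<open>The operator norm on the dual of \<open>P(X)\<close>; values of \<open>\<psi>\<close> off \<open>P(X)\<close> are ignored.\<close>

definition dual_norm ::
    "(complex^'n) set \<Rightarrow> (((complex^'n) \<Rightarrow> complex) \<Rightarrow> complex) \<Rightarrow> real" where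
  "dual_norm X \<psi> = (SUP f\<in>{f \<in> P_alg X. sup_norm X f \<le> 1}. cmod (\<psi> f))"

definition gleason_rel :: "(complex^'n) set \<Rightarrow> ((complex^'n) \<times> (complex^'n)) set" where
  "gleason_rel X = {(z, w). z \<in> poly_hull X \<and> w \<in> poly_hull X \<and>
     dual_norm X (\<lambda>f. eval_functional X z f - eval_functional X w f) < 2}"

definition gleason_parts :: "(complex^'n) set \<Rightarrow> (complex^'n) set set" where
  "gleason_parts X = poly_hull X // gleason_rel X"

definition one_point_gleason_part :: "(complex^'n) set \<Rightarrow> complex^'n \<Rightarrow> bool" where
  "one_point_gleason_part X x \<longleftrightarrow> {x} \<in> gleason_parts X"

section \<open>Well-definedness of the evaluation functionals\<close>

lemma holo_poly_monom: "holo_poly (\<lambda>z. c * (\<Prod>i\<in>UNIV. (z $ i) ^ \<alpha> i))"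
  unfolding holo_poly_def by (rule exI[of _ "{\<alpha>}"], rule exI[of _ "\<lambda>_. c"]) auto

lemma holo_poly_const: "holo_poly (\<lambda>z. c)"
  using holo_poly_monom[of c "\<lambda>_. 0"] by simp

lemma holo_poly_add:
  assumes "holo_poly p" "holo_poly q"
  shows "holo_poly (\<lambda>z. p z + q z)"
proof -
  obtain A c where A: "finite A" "p = (\<lambda>z. \<Sum>\<alpha>\<in>A. c \<alpha> * (\<Prod>i\<in>UNIV. (z $ i) ^ \<alpha> i))"
    using assms(1) unfolding holo_poly_def by blast
  obtain B d where B: "finite B" "q = (\<lambda>z. \<Sum>\<alpha>\<in>B. d \<alpha> * (\<Prod>i\<in>UNIV. (z $ i) ^ \<alpha> i))"
    using assms(2) unfolding holo_poly_def by blast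
  let ?e = "\<lambda>\<alpha>. (if \<alpha> \<in> A then c \<alpha> else 0) + (if \<alpha> \<in> B then d \<alpha> else 0)"
  have "p z + q z = (\<Sum>\<alpha>\<in>A \<union> B. ?e \<alpha> * (\<Prod>i\<in>UNIV. (z $ i) ^ \<alpha> i))" for z
  proof -
    have "p z = (\<Sum>\<alpha>\<in>A \<union> B. (if \<alpha> \<in> A then c \<alpha> else 0) * (\<Prod>i\<in>UNIV. (z $ i) ^ \<alpha> i))"
      unfolding A(2) by (rule sum.mono_neutral_cong_left) (use A B in auto)
    moreover have "q z = (\<Sum>\<alpha>\<in>A \<union> B. (if \<alpha> \<in> B then d \<alpha> else 0) * (\<Prod>i\<in>UNIV. (z $ i) ^ \<alpha> i))"
      unfolding B(2) by (rule sum.mono_neutral_cong_left) (use A B in auto)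
    ultimately show ?thesis by (simp add: ring_distribs sum.distrib)
  qed
  then show ?thesis
    unfolding holo_poly_def using A(1) B(1)
    by (intro exI[of _ "A \<union> B"] exI[of _ ?e]) auto
qed

lemma holo_poly_sum:
  assumes "finite I" "\<And>i. i \<in> I \<Longrightarrow> holo_poly (p i)"
  shows "holo_poly (\<lambda>z. \<Sum>i\<in>I. p i z)"
  using assms by (induction I rule: finite_induct) (auto intro: holo_poly_const holo_poly_add)

lemma holo_poly_mult:
  assumes "holo_poly p" "holo_poly q"
  shows "holo_poly (\<lambda>z. p z * q z)"
proof -
  obtain A c where A: "finite A" "p = (\<lambda>z. \<Sum>\<alpha>\<in>A. c \<alpha> * (\<Prod>i\<in>UNIV. (z $ i) ^ \<alpha> i))"
    using assms(1) unfolding holo_poly_def by blast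
  obtain B d where B: "finite B" "q = (\<lambda>z. \<Sum>\<alpha>\<in>B. d \<alpha> * (\<Prod>i\<in>UNIV. (z $ i) ^ \<alpha> i))"
    using assms(2) unfolding holo_poly_def by blast
  have "(\<lambda>z. p z * q z) =
      (\<lambda>z. \<Sum>\<alpha>\<in>A. \<Sum>\<beta>\<in>B. (c \<alpha> * d \<beta>) * (\<Prod>i\<in>UNIV. (z $ i) ^ (\<alpha> i + \<beta> i)))"
    unfolding A(2) B(2)
    by (simp add: sum_product power_add prod.distrib mult_ac)
  then show ?thesis
    by (simp only:) (intro holo_poly_sum A B holo_poly_monom)
qed

lemma holo_poly_diff: "holo_poly p \<Longrightarrow> holo_poly q \<Longrightarrow> holo_poly (\<lambda>z. p z - q z)"
  using holo_poly_add[of p "\<lambda>z. (-1) * q z"] holo_poly_mult[OF holo_poly_const, of q "-1"] by simp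

lemma holo_poly_continuous: "holo_poly p \<Longrightarrow> continuous_on S p"
  unfolding holo_poly_def by (auto intro!: continuous_intros)

lemma poly_hull_nonempty:
  assumes "z \<in> poly_hull X" shows "X \<noteq> {}"
proof
  assume "X = {}"
  let ?S = "Sup ({} :: real set)"
  have "cmod (complex_of_real (\<bar>?S\<bar> + 1)) \<le> ?S"
    using assms \<open>X = {}\<close> holo_poly_const[of "complex_of_real (\<bar>?S\<bar> + 1)"]
    unfolding poly_hull_def sup_norm_def by fastforce
  then show False by (simp only: norm_of_real)
qed

lemma mspace_C_space:
  assumes "compact X"
  shows "mspace (C_space X) = {f \<in> extensional X. continuous_on X f}"
  using assms
  by (auto simp: C_space_def Metric_space.fspace_def compact_imp_bounded compact_continuous_image)

lemma mdist_C_space: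
  assumes "compact X" "X \<noteq> {}" "f \<in> mspace (C_space X)" "g \<in> mspace (C_space X)"
  shows "mdist (C_space X) f g \<le> a \<longleftrightarrow> (\<forall>x\<in>X. cmod (f x - g x) \<le> a)"
  using assms cfunspace_mdist_le[of f "top_of_set X" euclidean_metric g a]
  unfolding C_space_def by (simp add: dist_norm)

lemma sup_norm_upper:
  assumes "compact X" "continuous_on X f" "x \<in> X"
  shows "cmod (f x) \<le> sup_norm X f"
  unfolding sup_norm_def
proof (rule cSUP_upper)
  have "compact ((\<lambda>x. cmod (f x)) ` X)"
    using assms by (intro compact_continuous_image continuous_intros)
  then show "bdd_above ((\<lambda>x. cmod (f x)) ` X)"
    by (rule bounded_imp_bdd_above[OF compact_imp_bounded])
qed fact

lemma sup_norm_least: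
  assumes "X \<noteq> {}" "\<And>x. x \<in> X \<Longrightarrow> cmod (f x) \<le> a"
  shows "sup_norm X f \<le> a"
  unfolding sup_norm_def using assms by (auto intro: cSUP_least)

lemma poly_hull_le:
  assumes "z \<in> poly_hull X" "holo_poly p" "\<And>x. x \<in> X \<Longrightarrow> cmod (p x) \<le> a"
  shows "cmod (p z) \<le> a"
  using assms sup_norm_least[OF poly_hull_nonempty[OF assms(1)], of p a]
  unfolding poly_hull_def by force

lemma P_alg_iff:
  assumes "compact X" "X \<noteq> {}"
  shows "f \<in> P_alg X \<longleftrightarrow> f \<in> extensional X \<and> continuous_on X f \<and>
    (\<forall>e>0. \<exists>p. holo_poly p \<and> (\<forall>x\<in>X. cmod (f x - p x) \<le> e))"
proof -
  interpret C: Metric_space "mspace (C_space X)" "mdist (C_space X)"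
    by (rule Metric_space_mspace_mdist)
  have poly: "restrict p X \<in> mspace (C_space X)" if "holo_poly p" for p
    using that assms by (simp add: mspace_C_space holo_poly_continuous cong: continuous_on_cong)
  have "f \<in> P_alg X \<longleftrightarrow> f \<in> mspace (C_space X) \<and>
     (\<forall>r>0. \<exists>p. holo_poly p \<and> mdist (C_space X) f (restrict p X) \<le> r)"
    using poly unfolding P_alg_def mtopology_of_def C.metric_closure_of_alt C.mcball_def
    by (simp add: Bex_def) blast
  also have "\<dots> \<longleftrightarrow> f \<in> mspace (C_space X) \<and>
     (\<forall>r>0. \<exists>p. holo_poly p \<and> (\<forall>x\<in>X. cmod (f x - p x) \<le> r))"
    using poly mdist_C_space[OF assms, of f] by (auto cong: conj_cong)
  finally show ?thesis using assms by (simp add: mspace_C_space conj_assoc)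
qed

lemma poly_in_P_alg:
  assumes "compact X" "X \<noteq> {}" "holo_poly p"
  shows "restrict p X \<in> P_alg X"
  using assms by (auto simp: P_alg_iff holo_poly_continuous cong: continuous_on_cong intro!: exI[of _ p])


text \<open>\<open>approx_at X z f c\<close>: \<open>c\<close> is the limit at \<open>z\<close> of polynomials converging uniformly
  to \<open>f\<close> on \<open>X\<close>.\<close>

definition approx_at ::
    "(complex^'n) set \<Rightarrow> complex^'n \<Rightarrow> ((complex^'n) \<Rightarrow> complex) \<Rightarrow> complex \<Rightarrow> bool" where
  "approx_at X z f c \<longleftrightarrow>
     (\<forall>e>0. \<exists>p. holo_poly p \<and> (\<forall>x\<in>X. cmod (f x - p x) \<le> e) \<and> cmod (c - p z) \<le> e)"

lemma approx_at_dist_le: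
  assumes z: "z \<in> poly_hull X" and "approx_at X z f c" "approx_at X z g d"
    and fg: "\<And>x. x \<in> X \<Longrightarrow> cmod (f x - g x) \<le> a"
  shows "cmod (c - d) \<le> a"
proof (rule field_le_epsilon)
  fix e :: real assume "e > 0"
  then have e: "e/4 > 0" by simp
  obtain p where p: "holo_poly p" "\<forall>x\<in>X. cmod (f x - p x) \<le> e/4" "cmod (c - p z) \<le> e/4"
    using assms(2) e unfolding approx_at_def by blast
  obtain q where q: "holo_poly q" "\<forall>x\<in>X. cmod (g x - q x) \<le> e/4" "cmod (d - q z) \<le> e/4"
    using assms(3) e unfolding approx_at_def by blast
  have "cmod (p x - q x) \<le> a + e/2" if "x \<in> X" for x
  proof -
    have "p x - q x = (f x - g x) - (f x - p x) + (g x - q x)" by simp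
    also have "cmod \<dots> \<le> cmod (f x - g x) + cmod (f x - p x) + cmod (g x - q x)"
      by (meson norm_triangle_ineq norm_triangle_ineq4 add_right_mono order_trans)
    finally show ?thesis using fg[OF that] p(2) q(2) that by fastforce
  qed
  then have "cmod (p z - q z) \<le> a + e/2"
    using poly_hull_le[OF z holo_poly_diff[OF p(1) q(1)]] by blast
  moreover have "cmod (c - d) \<le> cmod (p z - q z) + cmod (c - p z) + cmod (d - q z)"
  proof -
    have "c - d = (p z - q z) + (c - p z) - (d - q z)" by simp
    also have "cmod \<dots> \<le> cmod (p z - q z) + cmod (c - p z) + cmod (d - q z)"
      by (meson norm_triangle_ineq norm_triangle_ineq4 add_right_mono order_trans)
    finally show ?thesis .
  qed
  ultimately show "cmod (c - d) \<le> a + e" using p(3) q(3) by simp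
qed

lemma approx_at_unique:
  assumes "z \<in> poly_hull X" "approx_at X z f c" "approx_at X z f d"
  shows "c = d"
  using approx_at_dist_le[OF assms, of 0] by simp

lemma approx_at_poly: "holo_poly p \<Longrightarrow> approx_at X z (restrict p X) (p z)"
  unfolding approx_at_def by (auto intro!: exI[of _ p])

lemma approx_at_add:
  assumes "approx_at X z f c" "approx_at X z g d"
  shows "approx_at X z (\<lambda>x\<in>X. f x + g x) (c + d)"
  unfolding approx_at_def
proof (intro allI impI)
  fix e :: real assume "e > 0"
  then have e: "e/2 > 0" by simp
  obtain p where p: "holo_poly p" "\<forall>x\<in>X. cmod (f x - p x) \<le> e/2" "cmod (c - p z) \<le> e/2"
    using assms(1) e unfolding approx_at_def by blast
  obtain q where q: "holo_poly q" "\<forall>x\<in>X. cmod (g x - q x) \<le> e/2" "cmod (d - q z) \<le> e/2"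
    using assms(2) e unfolding approx_at_def by blast
  have *: "cmod ((a + b) - (a' + b')) \<le> e" if "cmod (a - a') \<le> e/2" "cmod (b - b') \<le> e/2"
    for a b a' b'
    using norm_triangle_mono[OF that] by (simp add: algebra_simps)
  show "\<exists>p. holo_poly p \<and> (\<forall>x\<in>X. cmod ((\<lambda>x\<in>X. f x + g x) x - p x) \<le> e) \<and>
      cmod (c + d - p z) \<le> e"
    using p q by (intro exI[of _ "\<lambda>z. p z + q z"]) (auto intro!: holo_poly_add *)
qed

lemma approx_at_mult:
  assumes "approx_at X z f c" "approx_at X z g d"
    and "bounded (f ` X)" "bounded (g ` X)"
  shows "approx_at X z (\<lambda>x\<in>X. f x * g x) (c * d)"
proof -
  obtain M1 M2 where M12: "\<forall>x\<in>X. cmod (f x) \<le> M1" "\<forall>x\<in>X. cmod (g x) \<le> M2"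
    using assms(3,4) unfolding bounded_iff by auto
  define M where "M = 1 + \<bar>M1\<bar> + \<bar>M2\<bar> + cmod c + cmod d"
  have "M > 0" "M1 \<le> M" "M2 \<le> M" and cd: "cmod c \<le> M" "cmod d \<le> M"
    unfolding M_def using norm_ge_zero[of c] norm_ge_zero[of d] by linarith+
  with M12 have M: "M > 0" "\<forall>x\<in>X. cmod (f x) \<le> M" "\<forall>x\<in>X. cmod (g x) \<le> M"
    "cmod c \<le> M" "cmod d \<le> M"
    by (blast intro: order_trans)+
  show ?thesis
    unfolding approx_at_def
  proof (intro allI impI)
    fix e :: real assume "e > 0"
    define r where "r = min 1 (e / (2 * M + 1))"
    have r: "r > 0" "r \<le> 1" "r \<le> e / (2 * M + 1)"
      using \<open>e > 0\<close> M(1) by (simp_all add: r_def)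
    have re: "r * (2 * M + 1) \<le> e"
      using r(3) M(1) by (simp add: pos_le_divide_eq)
    obtain p where p: "holo_poly p" "\<forall>x\<in>X. cmod (f x - p x) \<le> r" "cmod (c - p z) \<le> r"
      using assms(1) r(1) unfolding approx_at_def by blast
    obtain q where q: "holo_poly q" "\<forall>x\<in>X. cmod (g x - q x) \<le> r" "cmod (d - q z) \<le> r"
      using assms(2) r(1) unfolding approx_at_def by blast
    have *: "cmod (a * b - a' * b') \<le> e"
      if "cmod (a - a') \<le> r" "cmod (b - b') \<le> r" "cmod a \<le> M" "cmod b \<le> M" for a b a' b'
    proof -
      have b': "cmod b' \<le> M + 1"
        using norm_triangle_ineq4[of b "b - b'"] that r(2) by simp
      have "a * b - a' * b' = a * (b - b') + (a - a') * b'" by (simp add: algebra_simps)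
      also have "cmod \<dots> \<le> cmod a * cmod (b - b') + cmod (a - a') * cmod b'"
        by (metis norm_mult norm_triangle_ineq)
      also have "\<dots> \<le> M * r + r * (M + 1)"
        using that b' r(1) M(1) by (intro add_mono mult_mono) auto
      finally show ?thesis using re by (simp add: algebra_simps)
    qed
    show "\<exists>p. holo_poly p \<and> (\<forall>x\<in>X. cmod ((\<lambda>x\<in>X. f x * g x) x - p x) \<le> e) \<and>
        cmod (c * d - p z) \<le> e"
      using p q M by (intro exI[of _ "\<lambda>z. p z * q z"]) (auto intro!: holo_poly_mult *)
  qed
qed

lemma approx_at_exists:
  assumes z: "z \<in> poly_hull X"
    and f: "\<forall>e>0. \<exists>p. holo_poly p \<and> (\<forall>x\<in>X. cmod (f x - p x) \<le> e)"
  shows "\<exists>c. approx_at X z f c"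
proof -
  have "\<forall>n. \<exists>p. holo_poly p \<and> (\<forall>x\<in>X. cmod (f x - p x) \<le> inverse (real (Suc n)))"
    using f by simp
  then obtain p where p: "\<And>n. holo_poly (p n)"
    "\<And>n x. x \<in> X \<Longrightarrow> cmod (f x - p n x) \<le> inverse (real (Suc n))"
    by metis
  have diff: "cmod (p m z - p n z) \<le> inverse (real (Suc m)) + inverse (real (Suc n))" for m n
  proof (rule poly_hull_le[OF z holo_poly_diff[OF p(1) p(1)]])
    fix x assume "x \<in> X"
    have "p m x - p n x = (f x - p n x) - (f x - p m x)" by simp
    also have "cmod \<dots> \<le> cmod (f x - p n x) + cmod (f x - p m x)" by (rule norm_triangle_ineq4)
    finally show "cmod (p m x - p n x) \<le> inverse (real (Suc m)) + inverse (real (Suc n))"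
      using p(2)[OF \<open>x \<in> X\<close>, of m] p(2)[OF \<open>x \<in> X\<close>, of n] by linarith
  qed
  have small: "inverse (real (Suc n)) \<le> inverse (real (Suc N))" if "N \<le> n" for n N
    using that by (simp add: field_simps)
  have "Cauchy (\<lambda>n. p n z)"
    unfolding Cauchy_def
  proof (intro allI impI)
    fix e :: real assume "e > 0"
    then obtain N where N: "inverse (real (Suc N)) < e/2" using reals_Archimedean[of "e/2"] by auto
    show "\<exists>N. \<forall>m\<ge>N. \<forall>n\<ge>N. dist (p m z) (p n z) < e"
    proof (intro exI[of _ N] allI impI)
      fix m n assume "m \<ge> N" "n \<ge> N"
      then show "dist (p m z) (p n z) < e"
        using diff[of m n] small[of N m] small[of N n] N unfolding dist_norm by linarith
    qed
  qed
  then obtain c where c: "(\<lambda>n. p n z) \<longlonglongrightarrow> c"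
    using Cauchy_convergent unfolding convergent_def by blast
  have "approx_at X z f c"
    unfolding approx_at_def
  proof (intro allI impI)
    fix e :: real assume "e > 0"
    obtain N1 where N1: "\<And>n. n \<ge> N1 \<Longrightarrow> cmod (p n z - c) < e"
      using c \<open>e > 0\<close> unfolding LIMSEQ_iff by blast
    obtain N2 where N2: "inverse (real (Suc N2)) < e" using reals_Archimedean \<open>e > 0\<close> by blast
    let ?n = "max N1 N2"
    show "\<exists>p. holo_poly p \<and> (\<forall>x\<in>X. cmod (f x - p x) \<le> e) \<and> cmod (c - p z) \<le> e"
    proof (intro exI[of _ "p ?n"] conjI ballI)
      show "cmod (f x - p ?n x) \<le> e" if "x \<in> X" for x
        using p(2)[OF that, of ?n] small[of N2 ?n] N2 by linarith
      show "cmod (c - p ?n z) \<le> e" using N1[of ?n] by (simp add: norm_minus_commute)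
    qed (rule p)
  qed
  then show ?thesis ..
qed

lemma P_alg_iff_approx_at:
  assumes "compact X" "z \<in> poly_hull X"
  shows "f \<in> P_alg X \<longleftrightarrow> f \<in> extensional X \<and> continuous_on X f \<and> (\<exists>c. approx_at X z f c)"
proof -
  have "(\<exists>c. approx_at X z f c) \<longleftrightarrow> (\<forall>e>0. \<exists>p. holo_poly p \<and> (\<forall>x\<in>X. cmod (f x - p x) \<le> e))"
    using approx_at_exists[OF assms(2), of f] unfolding approx_at_def by blast
  then show ?thesis using P_alg_iff[OF assms(1) poly_hull_nonempty[OF assms(2)], of f] by simp
qed

lemma P_alg_add:
  assumes "compact X" "z \<in> poly_hull X" "f \<in> P_alg X" "g \<in> P_alg X"
  shows "(\<lambda>x\<in>X. f x + g x) \<in> P_alg X"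
proof -
  have "continuous_on X (\<lambda>x\<in>X. f x + g x)"
    using assms by (auto simp: P_alg_iff_approx_at intro!: continuous_intros cong: continuous_on_cong)
  then show ?thesis
    using assms approx_at_add[of X z f _ g] by (fastforce simp: P_alg_iff_approx_at)
qed

lemma P_alg_bounded:
  assumes "compact X" "z \<in> poly_hull X" "f \<in> P_alg X"
  shows "bounded (f ` X)"
  using assms by (simp add: P_alg_iff_approx_at compact_continuous_image compact_imp_bounded)

lemma P_alg_mult:
  assumes "compact X" "z \<in> poly_hull X" "f \<in> P_alg X" "g \<in> P_alg X"
  shows "(\<lambda>x\<in>X. f x * g x) \<in> P_alg X"
proof -
  have "continuous_on X (\<lambda>x\<in>X. f x * g x)"
    using assms by (auto simp: P_alg_iff_approx_at intro!: continuous_intros cong: continuous_on_cong)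
  then show ?thesis
    using assms approx_at_mult[of X z f _ g] P_alg_bounded[OF assms(1,2)]
    by (fastforce simp: P_alg_iff_approx_at)
qed

lemma mult_functional_unique:
  assumes "mult_functional X \<phi>" "mult_functional X \<psi>"
    and "\<And>p. holo_poly p \<Longrightarrow> \<phi> (restrict p X) = \<psi> (restrict p X)"
    and X: "compact X" "X \<noteq> {}"
  shows "\<phi> = \<psi>"
proof (rule extensionalityI[of _ "P_alg X"])
  let ?T = "subtopology (mtopology_of (C_space X)) (P_alg X)"
  let ?S = "{restrict p X | p. holo_poly p}"
  fix f assume "f \<in> P_alg X"
  have "?S \<subseteq> P_alg X" using X by (auto intro: poly_in_P_alg)
  then have "f \<in> ?T closure_of ?S"
    using \<open>f \<in> P_alg X\<close> by (simp add: closure_of_subtopology Int_absorb1 P_alg_def)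
  moreover have "continuous_map ?T euclidean \<phi>" "continuous_map ?T euclidean \<psi>"
    using assms(1,2) by (auto simp: mult_functional_def)
  ultimately show "\<phi> f = \<psi> f"
    using forall_in_closure_of_eq[of f ?T ?S euclidean \<phi> \<psi>] assms(3) by auto
qed (use assms in \<open>auto simp: mult_functional_def\<close>)

lemma eval_functional_exists:
  assumes X: "compact X" and z: "z \<in> poly_hull X"
  shows "\<exists>\<phi>. mult_functional X \<phi> \<and> (\<forall>p. holo_poly p \<longrightarrow> \<phi> (restrict p X) = p z) \<and>
     (\<forall>f\<in>P_alg X. approx_at X z f (\<phi> f))"
proof -
  have ne: "X \<noteq> {}" using z by (rule poly_hull_nonempty)
  define \<phi> where "\<phi> = (\<lambda>f\<in>P_alg X. SOME c. approx_at X z f c)"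
  have \<phi>: "approx_at X z f (\<phi> f)" if "f \<in> P_alg X" for f
    using that P_alg_iff_approx_at[OF X z, of f] someI_ex[of "approx_at X z f"]
    by (simp add: \<phi>_def)
  have eq: "\<phi> f = c" if "f \<in> P_alg X" "approx_at X z f c" for f c
    using approx_at_unique[OF z \<phi>[OF that(1)] that(2)] .
  have poly: "\<phi> (restrict p X) = p z" if "holo_poly p" for p
    using that by (intro eq poly_in_P_alg X ne approx_at_poly)
  have add: "\<phi> (\<lambda>x\<in>X. f x + g x) = \<phi> f + \<phi> g" if "f \<in> P_alg X" "g \<in> P_alg X" for f g
    using that by (intro eq P_alg_add[OF X z] approx_at_add \<phi>)
  have mult: "\<phi> (\<lambda>x\<in>X. f x * g x) = \<phi> f * \<phi> g" if "f \<in> P_alg X" "g \<in> P_alg X" for f g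
    using that by (intro eq P_alg_mult[OF X z] approx_at_mult \<phi> P_alg_bounded[OF X z])
  have scale: "\<phi> (\<lambda>x\<in>X. a * f x) = a * \<phi> f" if "f \<in> P_alg X" for a f
    using mult[OF poly_in_P_alg[OF X ne holo_poly_const[of a]] that] poly[OF holo_poly_const[of a]]
    by (simp cong: restrict_cong)
  have "continuous_map (mtopology_of (submetric (C_space X) (P_alg X)))
      (mtopology_of euclidean_metric) \<phi>"
    unfolding mtopology_of_def
      Metric_space.metric_continuous_map[OF Metric_space_mspace_mdist Metric_space_mspace_mdist]
  proof (intro conjI ballI allI impI)
    fix f and e :: real
    assume f: "f \<in> mspace (submetric (C_space X) (P_alg X))" and "e > 0"
    show "\<exists>\<delta>>0. \<forall>g. g \<in> mspace (submetric (C_space X) (P_alg X)) \<and>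
        mdist (submetric (C_space X) (P_alg X)) f g < \<delta> \<longrightarrow>
        mdist euclidean_metric (\<phi> f) (\<phi> g) < e"
    proof (intro exI[of _ e] conjI allI impI \<open>e > 0\<close>)
      fix g
      assume g: "g \<in> mspace (submetric (C_space X) (P_alg X)) \<and>
        mdist (submetric (C_space X) (P_alg X)) f g < e"
      have "cmod (f x - g x) \<le> mdist (C_space X) f g" if "x \<in> X" for x
        using mdist_C_space[OF X ne, of f g] f g that by auto
      then have "cmod (\<phi> f - \<phi> g) \<le> mdist (C_space X) f g"
        using f g by (intro approx_at_dist_le[OF z \<phi> \<phi>]) auto
      then show "mdist euclidean_metric (\<phi> f) (\<phi> g) < e"
        using g by (simp add: dist_norm)
    qed
  qed simp
  then have "mult_functional X \<phi>"
    unfolding mult_functional_def using add scale mult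
    by (auto simp: \<phi>_def mtopology_of_submetric)
  then show ?thesis using poly \<phi> by blast
qed

lemma eval_functional_ex1:
  assumes "compact X" "z \<in> poly_hull X"
  shows "\<exists>!\<phi>. mult_functional X \<phi> \<and> (\<forall>p. holo_poly p \<longrightarrow> \<phi> (restrict p X) = p z)"
proof -
  obtain \<phi> where "mult_functional X \<phi>" "\<forall>p. holo_poly p \<longrightarrow> \<phi> (restrict p X) = p z"
    using eval_functional_exists[OF assms] by blast
  then show ?thesis
    by (intro ex1I[of _ \<phi>]) (auto intro!: mult_functional_unique[OF _ _ _ assms(1) poly_hull_nonempty[OF assms(2)]])
qed

lemma eval_functional:
  assumes "compact X" "z \<in> poly_hull X"
  shows "mult_functional X (eval_functional X z)"
    and "holo_poly p \<Longrightarrow> eval_functional X z (restrict p X) = p z"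
  using theI'[OF eval_functional_ex1[OF assms]] unfolding eval_functional_def by blast+

lemma approx_at_eval_functional:
  assumes "compact X" "z \<in> poly_hull X" "f \<in> P_alg X"
  shows "approx_at X z f (eval_functional X z f)"
proof -
  obtain \<phi> where \<phi>: "mult_functional X \<phi>" "\<forall>p. holo_poly p \<longrightarrow> \<phi> (restrict p X) = p z"
    "\<forall>f\<in>P_alg X. approx_at X z f (\<phi> f)"
    using eval_functional_exists[OF assms(1,2)] by blast
  then have "eval_functional X z = \<phi>"
    unfolding eval_functional_def by (intro the1_equality[OF eval_functional_ex1[OF assms(1,2)]]) blast
  then show ?thesis using \<phi>(3) assms(3) by simp
qed

lemma eval_functional_norm_le:
  assumes "compact X" "z \<in> poly_hull X" "f \<in> P_alg X"
  shows "cmod (eval_functional X z f) \<le> sup_norm X f"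
proof -
  have "approx_at X z (restrict (\<lambda>_. 0) X) 0"
    using approx_at_poly[OF holo_poly_const[of 0]] .
  moreover have "continuous_on X f" using assms by (simp add: P_alg_iff_approx_at)
  ultimately show ?thesis
    using approx_at_dist_le[OF assms(2) approx_at_eval_functional[OF assms], of "restrict (\<lambda>_. 0) X" 0]
      sup_norm_upper[OF assms(1)] by simp
qed

lemma dual_norm_eval_diff_le:
  assumes "compact X" "z \<in> poly_hull X" "w \<in> poly_hull X"
  shows "dual_norm X (\<lambda>f. eval_functional X z f - eval_functional X w f) \<le> 2"
  unfolding dual_norm_def
proof (rule cSUP_least)
  have ne: "X \<noteq> {}" using assms(2) by (rule poly_hull_nonempty)
  have "restrict (\<lambda>_. 0) X \<in> P_alg X" using assms(1) ne holo_poly_const by (rule poly_in_P_alg)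
  moreover have "sup_norm X (restrict (\<lambda>_. 0) X) \<le> 1" using ne by (rule sup_norm_least) simp
  ultimately show "{f \<in> P_alg X. sup_norm X f \<le> 1} \<noteq> {}" by blast
next
  fix f assume f: "f \<in> {f \<in> P_alg X. sup_norm X f \<le> 1}"
  then have "cmod (eval_functional X z f) \<le> 1" "cmod (eval_functional X w f) \<le> 1"
    using eval_functional_norm_le[OF assms(1,2), of f] eval_functional_norm_le[OF assms(1,3), of f]
    by auto
  then show "cmod (eval_functional X z f - eval_functional X w f) \<le> 2"
    using norm_triangle_ineq4[of "eval_functional X z f" "eval_functional X w f"] by linarith
qed

lemma gleason_rel_refl:
  assumes "compact X" "z \<in> poly_hull X"
  shows "(z, z) \<in> gleason_rel X"
proof -
  have ne: "X \<noteq> {}" using assms(2) by (rule poly_hull_nonempty)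
  have "restrict (\<lambda>_. 0) X \<in> P_alg X" using assms(1) ne holo_poly_const by (rule poly_in_P_alg)
  moreover have "sup_norm X (restrict (\<lambda>_. 0) X) \<le> 1" using ne by (rule sup_norm_least) simp
  ultimately have "{f \<in> P_alg X. sup_norm X f \<le> 1} \<noteq> {}" by blast
  then have "dual_norm X (\<lambda>f. eval_functional X z f - eval_functional X z f) \<le> 0"
    unfolding dual_norm_def by (intro cSUP_least) auto
  then show ?thesis using assms(2) by (simp add: gleason_rel_def)
qed

lemma one_point_gleason_part_iff:
  assumes "compact X"
  shows "one_point_gleason_part X x \<longleftrightarrow> x \<in> poly_hull X \<and>
    (\<forall>w\<in>poly_hull X - {x}.
       dual_norm X (\<lambda>f. eval_functional X x f - eval_functional X w f) = 2)"
proof -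
  have "one_point_gleason_part X x \<longleftrightarrow> x \<in> poly_hull X \<and> gleason_rel X `` {x} = {x}"
  proof
    assume "one_point_gleason_part X x"
    then obtain a where a: "a \<in> poly_hull X" "gleason_rel X `` {a} = {x}"
      unfolding one_point_gleason_part_def gleason_parts_def quotient_def by auto
    then have "a = x" using gleason_rel_refl[OF assms a(1)] by auto
    then show "x \<in> poly_hull X \<and> gleason_rel X `` {x} = {x}" using a by simp
  next
    assume "x \<in> poly_hull X \<and> gleason_rel X `` {x} = {x}"
    then show "one_point_gleason_part X x"
      unfolding one_point_gleason_part_def gleason_parts_def by (metis quotientI)
  qed
  also have "\<dots> \<longleftrightarrow> x \<in> poly_hull X \<and> (\<forall>w\<in>poly_hull X - {x}. (x, w) \<notin> gleason_rel X)"
    using gleason_rel_refl[OF assms] by (auto simp: gleason_rel_def)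
  also have "\<dots> \<longleftrightarrow> x \<in> poly_hull X \<and> (\<forall>w\<in>poly_hull X - {x}.
       dual_norm X (\<lambda>f. eval_functional X x f - eval_functional X w f) = 2)"
    using dual_norm_eval_diff_le[OF assms] by (force simp: gleason_rel_def)
  finally show ?thesis .
qed

end

theory Submission
  imports Defs "HOL-Complex_Analysis.Residue_Theorem"
begin

text \<open>
  The set \<open>X\<close> is cut out of the unit sphere by conditions \<open>\<bar>q\<^sub>k\<bar> \<le> \<delta>\<^sub>k\<close> with polynomials
  \<open>q\<^sub>k\<close> that vanish at the origin, chosen so that \<open>P(X)\<close> contains approximate roots of every order
  of the functions \<open>z\<^sub>i - a\<close>.

  Such roots isolate the origin. If \<open>w \<noteq> 0\<close> lies in the hull, say \<open>w\<^sub>i \<noteq> 0\<close>, let \<open>h\<close> be a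
  polynomial with \<open>h\<^sup>N\<close> very close to \<open>z\<^sub>i - w\<^sub>i\<close> on \<open>X\<close>, hence on the hull. For large \<open>N\<close> the
  modulus of \<open>h\<close> at the origin is about \<open>\<bar>w\<^sub>i\<bar>\<close> to the power \<open>1/N\<close>, thus close to 1, its
  supremum on \<open>X\<close> is bounded by a number close to 1, and \<open>h(w)\<close> is as close to 0 as desired. A
  polynomial approximation of a Moebius transformation of the disc that sends \<open>0\<close> close to \<open>-1\<close> and
  fixes \<open>1\<close> turns this into a function of norm at most 1 whose values at \<open>0\<close> and \<open>w\<close> differ by
  almost 2 (\<open>approximate_roots_separate\<close>).

  A root of a polynomial \<open>f\<close> is adjoined as follows (\<open>adjoin_approximate_root\<close>). Given \<open>q\<close> with
  \<open>q(0) = 0\<close>, choose \<open>b\<close> with \<open>b\<^sup>N = f(0)\<close> and put \<open>q' = (q + \<rho>b)\<^sup>N - \<rho>\<^sup>N f\<close> for a small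
  \<open>\<rho> > 0\<close>. On the zero set of \<open>q'\<close> the polynomial \<open>h = (q + \<rho>b)/\<rho>\<close> is an exact \<open>N\<close>-th root of
  \<open>f\<close>, so it is an approximate root where \<open>\<bar>q'\<bar>\<close> is small; there \<open>h\<close> is bounded independently of
  \<open>\<rho>\<close>, and therefore \<open>q = \<rho>(h - b)\<close> is small too. So the new condition implies the old one,
  and \<open>b\<close> is chosen such that \<open>q'(0) = 0\<close>.

  The origin stays in the hull at every stage, because it lies on the zero set of \<open>q\<^sub>k\<close> and
  polynomials satisfy the maximum principle on the part of this zero set in the ball
  (\<open>zero_set_maximum_principle\<close>). Compactness carries this over to the intersection \<open>X\<close> of all
  stages. The maximum principle rests on the fact that in at least two complex dimensions zero
  sets have no isolated points: the values of a polynomial over the nearby points of the zero set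
  add up to a holomorphic function of one variable, to which the maximum modulus principle applies
  (\<open>zero_set_no_strict_local_max\<close>).
\<close>

section \<open>Polynomials in several variables\<close>

lemma holo_poly_coord: "holo_poly (\<lambda>z :: complex^'n. z $ i)"
proof -
  have "(\<lambda>z :: complex^'n. z $ i) = (\<lambda>z. 1 * (\<Prod>j\<in>UNIV. (z $ j) ^ (if j = i then 1 else 0)))"
  proof
    fix z :: "complex^'n"
    have "(\<Prod>j\<in>UNIV. (z $ j) ^ (if j = i then 1 else 0)) = (\<Prod>j\<in>UNIV. if j = i then z $ j else 1)"
      by (rule prod.cong) auto
    then show "z $ i = 1 * (\<Prod>j\<in>UNIV. (z $ j) ^ (if j = i then 1 else 0))" by simp
  qed
  then show ?thesis
    using holo_poly_monom[of 1 "\<lambda>j. if j = i then 1 else 0"] by (simp only:)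
qed

lemma holo_poly_power: "holo_poly p \<Longrightarrow> holo_poly (\<lambda>z. p z ^ N)"
  by (induction N) (auto intro: holo_poly_const holo_poly_mult)

text \<open>Polynomials are defined by sums over multi-indices; this rule replaces the bookkeeping with
  exponents by closure properties.\<close>

lemma holo_poly_induct [consumes 1, case_names const coord add mult]:
  fixes p :: "complex^'n \<Rightarrow> complex" and P :: "((complex^'n) \<Rightarrow> complex) \<Rightarrow> bool"
  assumes "holo_poly p"
    and const: "\<And>c. P (\<lambda>z. c)"
    and coord: "\<And>i. P (\<lambda>z. z $ i)"
    and add: "\<And>p q. holo_poly p \<Longrightarrow> holo_poly q \<Longrightarrow> P p \<Longrightarrow> P q \<Longrightarrow> P (\<lambda>z. p z + q z)"
    and mult: "\<And>p q. holo_poly p \<Longrightarrow> holo_poly q \<Longrightarrow> P p \<Longrightarrow> P q \<Longrightarrow> P (\<lambda>z. p z * q z)"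
  shows "P p"
proof -
  define P' where "P' p \<longleftrightarrow> holo_poly p \<and> P p" for p
  have const': "P' (\<lambda>z. c)" and coord': "P' (\<lambda>z. z $ i)" for c i
    unfolding P'_def by (auto intro: const coord holo_poly_const holo_poly_coord)
  have add': "P' (\<lambda>z. p z + q z)" and mult': "P' (\<lambda>z. p z * q z)" if "P' p" "P' q" for p q
    using that unfolding P'_def by (auto intro: add mult holo_poly_add holo_poly_mult)
  have power: "P' (\<lambda>z. (z $ i) ^ k)" for i k
    by (induction k) (auto intro: const' coord' mult')
  have monom: "P' (\<lambda>z. \<Prod>i\<in>I. (z $ i) ^ \<alpha> i)" for I \<alpha>
    by (induction I rule: infinite_finite_induct) (auto intro: const' power mult')
  have sum: "P' (\<lambda>z. \<Sum>\<alpha>\<in>A. c \<alpha> * (\<Prod>i\<in>UNIV. (z $ i) ^ \<alpha> i))" for A c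
    by (induction A rule: infinite_finite_induct) (auto intro!: const' add' mult' monom)
  obtain A c where "p = (\<lambda>z. \<Sum>\<alpha>\<in>A. c \<alpha> * (\<Prod>i\<in>UNIV. (z $ i) ^ \<alpha> i))"
    using assms(1) unfolding holo_poly_def by blast
  then show ?thesis using sum[of c A] by (simp only: P'_def)
qed

lemma holo_poly_directional_derivative:
  fixes p :: "complex^'n \<Rightarrow> complex"
  assumes "holo_poly p"
  obtains p' where "holo_poly p'"
    "\<And>z t. ((\<lambda>t. p (z + t *s v)) has_field_derivative p' (z + t *s v)) (at t)"
proof -
  have "\<exists>p'. holo_poly p' \<and>
      (\<forall>z t. ((\<lambda>t. p (z + t *s v)) has_field_derivative p' (z + t *s v)) (at t))"
    using assms
  proof (induction rule: holo_poly_induct)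
    case (const c)
    show ?case by (rule exI[of _ "\<lambda>_. 0"]) (auto intro: holo_poly_const)
  next
    case (coord i)
    show ?case
      by (rule exI[of _ "\<lambda>_. v $ i"]) (auto intro!: holo_poly_const derivative_eq_intros)
  next
    case (add p q)
    obtain p' where p': "holo_poly p'"
      "\<And>z t. ((\<lambda>t. p (z + t *s v)) has_field_derivative p' (z + t *s v)) (at t)"
      using add.IH(1) by blast
    obtain q' where q': "holo_poly q'"
      "\<And>z t. ((\<lambda>t. q (z + t *s v)) has_field_derivative q' (z + t *s v)) (at t)"
      using add.IH(2) by blast
    show ?case
      by (intro exI[of _ "\<lambda>z. p' z + q' z"] conjI allI holo_poly_add DERIV_add p' q')
  next
    case (mult p q)
    obtain p' where p': "holo_poly p'"
      "\<And>z t. ((\<lambda>t. p (z + t *s v)) has_field_derivative p' (z + t *s v)) (at t)"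
      using mult.IH(1) by blast
    obtain q' where q': "holo_poly q'"
      "\<And>z t. ((\<lambda>t. q (z + t *s v)) has_field_derivative q' (z + t *s v)) (at t)"
      using mult.IH(2) by blast
    show ?case
      by (intro exI[of _ "\<lambda>z. p' z * q z + q' z * p z"] conjI allI
          holo_poly_add holo_poly_mult mult.hyps DERIV_mult p' q')
  qed
  then show thesis using that by blast
qed

lemma holo_poly_on_line:
  fixes p :: "complex^'n \<Rightarrow> complex"
  assumes "holo_poly p"
  obtains Q where "\<And>t. p (z + t *s v) = poly Q t"
proof -
  have "\<exists>Q. \<forall>t. p (z + t *s v) = poly Q t"
    using assms
  proof (induction rule: holo_poly_induct)
    case (const c)
    show ?case by (rule exI[of _ "[:c:]"]) simp
  next
    case (coord i)
    show ?case by (rule exI[of _ "[:z $ i, v $ i:]"]) (simp add: mult_ac)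
  next
    case (add p q)
    then obtain P Q where "\<forall>t. p (z + t *s v) = poly P t" "\<forall>t. q (z + t *s v) = poly Q t"
      by blast
    then show ?case by (intro exI[of _ "P + Q"]) simp
  next
    case (mult p q)
    then obtain P Q where "\<forall>t. p (z + t *s v) = poly P t" "\<forall>t. q (z + t *s v) = poly Q t"
      by blast
    then show ?case by (intro exI[of _ "P * Q"]) simp
  qed
  then show thesis using that by blast
qed

lemma holo_poly_poly: "holo_poly h \<Longrightarrow> holo_poly (\<lambda>z. poly \<Phi> (h z))"
  by (induction \<Phi>) (auto intro: holo_poly_const holo_poly_add holo_poly_mult)

section \<open>The maximum principle on zero sets of polynomials\<close>

text \<open>The argument principle for a circle, whose winding number is 1 around the points inside and 0
  around those outside.\<close>

lemma circle_integral_log_derivative: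
  fixes f h :: "complex \<Rightarrow> complex"
  assumes f: "\<And>t. (f has_field_derivative f' t) (at t)" and h: "h holomorphic_on UNIV"
    and fin: "finite {t. f t = 0}" and "r > 0" and nz: "\<And>t. cmod t = r \<Longrightarrow> f t \<noteq> 0"
  shows "contour_integral (circlepath 0 r) (\<lambda>t. f' t * h t / f t) =
      2 * pi * \<i> * (\<Sum>t\<in>{t \<in> ball 0 r. f t = 0}. of_int (zorder f t) * h t)" (is ?int)
    and "\<And>t. f t = 0 \<Longrightarrow> zorder f t > 0"
proof -
  have fh: "f holomorphic_on UNIV"
    using f by (auto simp: holomorphic_on_def field_differentiable_def)
  have "deriv f t = f' t" for t using f by (rule DERIV_imp_deriv)
  moreover have "contour_integral (circlepath 0 r) (\<lambda>t. deriv f t * h t / f t) =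
      2 * pi * \<i> * (\<Sum>t\<in>{t \<in> UNIV. f t = 0 \<or> t \<in> {}}.
        winding_number (circlepath 0 r) t * h t * of_int (zorder f t))"
  proof (rule argument_principle)
    show "path_image (circlepath 0 r) \<subseteq> UNIV - {t \<in> UNIV. f t = 0 \<or> t \<in> {}}"
      using nz \<open>r > 0\<close> by auto
  qed (use fh h fin connected_UNIV in simp_all)
  moreover have "(\<Sum>t\<in>{t \<in> UNIV. f t = 0 \<or> t \<in> {}}.
        winding_number (circlepath 0 r) t * h t * of_int (zorder f t)) =
      (\<Sum>t\<in>{t \<in> ball 0 r. f t = 0}. of_int (zorder f t) * h t)"
  proof (rule sum.mono_neutral_cong_right)
    show "\<forall>t\<in>{t \<in> UNIV. f t = 0 \<or> t \<in> {}} - {t \<in> ball 0 r. f t = 0}.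
        winding_number (circlepath 0 r) t * h t * of_int (zorder f t) = 0"
    proof
      fix t assume t: "t \<in> {t \<in> UNIV. f t = 0 \<or> t \<in> {}} - {t \<in> ball 0 r. f t = 0}"
      then have "cmod t \<noteq> r" "\<not> cmod t < r" using nz[of t] by auto
      then have "t \<notin> cball 0 r" by simp
      then have "winding_number (circlepath 0 r) t = 0"
        using \<open>r > 0\<close> by (intro winding_number_zero_outside[of _ "cball 0 r"]) (auto simp: sphere_def)
      then show "winding_number (circlepath 0 r) t * h t * of_int (zorder f t) = 0" by simp
    qed
    show "winding_number (circlepath 0 r) t * h t * of_int (zorder f t) = of_int (zorder f t) * h t"
      if "t \<in> {t \<in> ball 0 r. f t = 0}" for t
      using that by (subst winding_number_circlepath) auto
  qed (use fin in simp_all, blast)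
  ultimately show ?int by simp
  fix t assume "f t = 0"
  have "\<exists>w\<in>UNIV. f w \<noteq> 0" using nz[of "of_real r"] \<open>r > 0\<close> by auto
  then show "zorder f t > 0"
    using zorder_exist_zero[OF fh, of t] \<open>f t = 0\<close> by auto
qed

text \<open>Near \<open>z0\<close> the zero set is fibred over a disc of parameters \<open>s\<close>, the fibre \<open>Z s\<close> being the set of
  zeros of \<open>t \<mapsto> q (P s t)\<close> in a small disc, and the central fibre being just \<open>z0\<close>. The sum
  \<open>E s\<close> of the values of \<open>g\<close> over \<open>Z s\<close>, counted with multiplicity, is a contour integral and
  therefore holomorphic in \<open>s\<close>. If \<open>Re g\<close> were negative on the zero set away from \<open>z0\<close>, then
  \<open>Re E\<close> would have the maximum \<open>0\<close> at the centre and hence vanish identically, which is possible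
  only if the fibres over \<open>s \<noteq> 0\<close> are empty. But the number of points in a fibre is again such an
  integral, hence continuous in \<open>s\<close>, and it is positive at \<open>s = 0\<close>. Two dimensions are needed
  for the direction \<open>u\<close>, which makes the fibres over \<open>s \<noteq> 0\<close> miss \<open>z0\<close>.\<close>

lemma zero_set_no_strict_local_max:
  fixes q g :: "complex^'n \<Rightarrow> complex"
  assumes n: "2 \<le> CARD('n)" and q: "holo_poly q" and g: "holo_poly g"
    and y: "q y \<noteq> 0" and z0: "q z0 = 0" "g z0 = 0" and R: "R > 0"
  shows "\<exists>z. z \<noteq> z0 \<and> dist z z0 < R \<and> q z = 0 \<and> 0 \<le> Re (g z)"
proof (rule ccontr)
  assume contra: "\<not> ?thesis"
  then have neg: "Re (g z) < 0" if "z \<noteq> z0" "dist z z0 < R" "q z = 0" for z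
    using that by force
  \<comment> \<open>The direction \<open>v\<close> of the fibres is one along which \<open>q\<close> does not vanish identically.\<close>
  define v where "v = y - z0"
  have "v \<noteq> 0" using y z0(1) by (auto simp: v_def)
  then obtain i where i: "v $ i \<noteq> 0" by (auto simp: vec_eq_iff)
  obtain j where j: "j \<noteq> i"
  proof -
    have "UNIV \<noteq> {i}" using n by (metis card_1_singleton_iff Suc_1 not_less_eq_eq One_nat_def le_refl)
    then show thesis using that by blast
  qed
  define u :: "complex^'n" where "u = axis j 1"
  define P where "P s t = z0 + s *s u + t *s v" for s t
  have P_alt: "P s t = z0 + t *s v + s *s u" for s t by (simp add: P_def)
  have P00: "P 0 0 = z0" by (simp add: P_def)
  have P01: "P 0 1 = y" by (simp add: P_def v_def)
  have P_ne: "P s t \<noteq> z0" if "s \<noteq> 0" for s t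
  proof
    assume "P s t = z0"
    then have "s *s u + t *s v = 0" by (simp add: P_def)
    then have *: "s * u $ k + t * v $ k = 0" for k by (metis vector_add_component vector_smult_component zero_index)
    have "t = 0" using *[of i] i j by (simp add: u_def axis_def)
    then show False using *[of j] that by (simp add: u_def axis_def)
  qed
  have contP: "continuous_on S (\<lambda>x. P (a x) (b x))"
    if "continuous_on S a" "continuous_on S b" for S :: "'b::topological_space set" and a b
    unfolding P_def vector_scalar_mult_def by (intro continuous_intros that)
  have contPo: "continuous_on S (\<lambda>x. h (P (a x) (b x)))"
    if "holo_poly h" "continuous_on S a" "continuous_on S b"
    for S :: "'b::topological_space set" and a b h
    using continuous_on_compose2[OF holo_poly_continuous[OF that(1), of UNIV] contP[OF that(2,3)]] by simp

  obtain d where d: "d > 0" "\<And>s t. cmod s < d \<Longrightarrow> cmod t < d \<Longrightarrow> dist (P s t) z0 < R"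
  proof -
    have "open {x. dist (P (fst x) (snd x)) z0 < R}"
      by (intro open_Collect_less continuous_intros contP)
    moreover have "(0, 0) \<in> {x. dist (P (fst x) (snd x)) z0 < R}" using P00 R by simp
    ultimately obtain e where e: "e > 0" "ball (0, 0) e \<subseteq> {x. dist (P (fst x) (snd x)) z0 < R}"
      by (meson openE)
    have "dist (P s t) z0 < R" if "cmod s < e / 2" "cmod t < e / 2" for s t
    proof -
      have "norm (s, t) < e" using norm_Pair_le[of s t] that by linarith
      then have "(s, t) \<in> ball (0, 0) e" by (simp add: dist_norm norm_Pair)
      then show ?thesis using e(2) by auto
    qed
    then show thesis using that[of "e / 2"] e(1) by simp
  qed
  have fin: "finite {t. q (P s t) = 0}" if "q (P s t') \<noteq> 0" for s t'
  proof -
    obtain Q where Q: "\<And>t. q (z0 + s *s u + t *s v) = poly Q t" using holo_poly_on_line[OF q] by blast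
    have "Q \<noteq> 0" using that unfolding P_def Q by force
    then show ?thesis using poly_roots_finite[of Q] by (simp add: P_def Q)
  qed
  obtain r where r: "r > 0" "\<And>t. cmod t \<le> r \<Longrightarrow> cmod t < d"
      "\<And>t. cmod t \<le> r \<Longrightarrow> t \<noteq> 0 \<Longrightarrow> q (P 0 t) \<noteq> 0"
    using finite_cball_avoid[of "ball 0 d" "{t. q (P 0 t) = 0}" 0] fin[of 0 1] y P01 d(1) by auto
  obtain \<rho> where \<rho>: "\<rho> > 0" "\<And>s t. cmod s < \<rho> \<Longrightarrow> cmod t = r \<Longrightarrow> q (P s t) \<noteq> 0"
      "\<And>s. cmod s < \<rho> \<Longrightarrow> cmod s < d"
  proof -
    have "open {x. q (P (fst x) (snd x)) \<noteq> 0}"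
      by (intro open_Collect_neq contPo[OF q] continuous_intros)
    moreover have "q (P 0 t) \<noteq> 0" if "t \<in> sphere 0 r" for t
    proof (rule r(3))
      show "cmod t \<le> r" "t \<noteq> 0" using that r(1) by auto
    qed
    then have "{0} \<times> sphere 0 r \<subseteq> {x. q (P (fst x) (snd x)) \<noteq> 0}" by auto
    ultimately have "\<exists>X0. 0 \<in> X0 \<and> open X0 \<and> X0 \<times> sphere 0 r \<subseteq> {x. q (P (fst x) (snd x)) \<noteq> 0}"
      by (intro Elementary_Topology.tube_lemma compact_sphere)
    then obtain X0 where X0: "0 \<in> X0" "open X0"
        "X0 \<times> sphere 0 r \<subseteq> {x. q (P (fst x) (snd x)) \<noteq> 0}"
      by blast
    then obtain e where e: "e > 0" "ball 0 e \<subseteq> X0" by (meson openE)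
    have "q (P s t) \<noteq> 0" if "cmod s < e" "cmod t = r" for s t
    proof -
      have "(s, t) \<in> X0 \<times> sphere 0 r" using that e(2) by auto
      from subsetD[OF X0(3) this] show ?thesis by simp
    qed
    then show thesis using that[of "min e d"] e(1) d(1) by simp
  qed

  obtain qv where qv: "holo_poly qv"
    "\<And>z t. ((\<lambda>t. q (z + t *s v)) has_field_derivative qv (z + t *s v)) (at t)"
    using holo_poly_directional_derivative[OF q] by metis
  \<comment> \<open>Differentiation under the integral sign needs the derivatives in the base direction \<open>u\<close>.\<close>
  have deriv_u: "\<exists>h'. holo_poly h' \<and>
      (\<forall>s t A. ((\<lambda>s. h (P s t)) has_field_derivative h' (P s t)) (at s within A))" if "holo_poly h" for h
    using holo_poly_directional_derivative[OF that, of u] unfolding P_alt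
    by (metis has_field_derivative_at_within)
  define I where "I h s = contour_integral (circlepath 0 r) (\<lambda>t. qv (P s t) * h (P s t) / q (P s t))"
    for h s
  define Z where "Z s = {t \<in> ball 0 r. q (P s t) = 0}" for s
  define m :: "complex \<Rightarrow> complex \<Rightarrow> real" where "m s t = of_int (zorder (\<lambda>t. q (P s t)) t)" for s t
  have val: "I h s = 2 * pi * \<i> * (\<Sum>t\<in>Z s. of_real (m s t) * h (P s t))"
    and mpos: "\<And>t. t \<in> Z s \<Longrightarrow> 0 < m s t" and Zfin: "finite (Z s)"
    if h: "holo_poly h" and s: "cmod s < \<rho>" for h s
  proof -
    have fin_s: "finite {t. q (P s t) = 0}"
      using \<rho>(2)[OF s, of "of_real r"] r(1) by (intro fin) auto
    have der: "((\<lambda>t. q (P s t)) has_field_derivative qv (P s t)) (at t)" for t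
      unfolding P_def by (rule qv)
    have "(\<lambda>t. h (P s t)) holomorphic_on UNIV"
      using holo_poly_directional_derivative[OF h, of v] unfolding P_def holomorphic_on_def
      by (metis field_differentiable_def field_differentiable_at_within)
    note * = circle_integral_log_derivative[OF der this fin_s r(1) \<rho>(2)[OF s]]
    show "I h s = 2 * pi * \<i> * (\<Sum>t\<in>Z s. of_real (m s t) * h (P s t))"
      unfolding I_def Z_def m_def using *(1) by simp
    show "0 < m s t" if "t \<in> Z s" for t using *(2)[of t] that by (simp add: Z_def m_def)
    show "finite (Z s)" unfolding Z_def by (rule finite_subset[OF _ fin_s]) auto
  qed
  have hol: "I h holomorphic_on ball 0 \<rho>" if h: "holo_poly h" for h
  proof -
    obtain h' where h': "holo_poly h'"
      "\<And>s t A. ((\<lambda>s. h (P s t)) has_field_derivative h' (P s t)) (at s within A)"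
      using deriv_u[OF h] by metis
    obtain q' where q': "holo_poly q'"
      "\<And>s t A. ((\<lambda>s. q (P s t)) has_field_derivative q' (P s t)) (at s within A)"
      using deriv_u[OF q] by metis
    obtain qv' where qv': "holo_poly qv'"
      "\<And>s t A. ((\<lambda>s. qv (P s t)) has_field_derivative qv' (P s t)) (at s within A)"
      using deriv_u[OF qv(1)] by metis
    let ?c = "circlepath 0 r"
    define w where "w x = 2 * pi * \<i> * r * exp (2 * of_real pi * \<i> * of_real x)" for x
    define F where "F s x = qv (P s (?c x)) * h (P s (?c x)) / q (P s (?c x)) * w x" for s x
    define F' where "F' s x =
      ((qv' (P s (?c x)) * h (P s (?c x)) + h' (P s (?c x)) * qv (P s (?c x))) * q (P s (?c x))
        - (qv (P s (?c x)) * h (P s (?c x))) * q' (P s (?c x))) / (q (P s (?c x)) * q (P s (?c x))) * w x" for s x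
    have c: "continuous_on S ?c" for S
      unfolding circlepath by (intro continuous_intros)
    have nz: "q (P s (?c x)) \<noteq> 0" if "s \<in> ball 0 \<rho>" for s x
      using that r(1) by (intro \<rho>(2)) (auto simp: circlepath norm_mult)
    have "(\<lambda>s. integral (cbox 0 1) (F s)) holomorphic_on ball 0 \<rho>"
    proof (rule leibniz_rule_holomorphic)
      show "((\<lambda>s. F s x) has_field_derivative F' s x) (at s within ball 0 \<rho>)" if "s \<in> ball 0 \<rho>" for s x
        unfolding F_def F'_def using nz[OF that]
        by (intro DERIV_cmult_right DERIV_divide DERIV_mult h' q' qv')
      show "F s integrable_on cbox 0 1" if "s \<in> ball 0 \<rho>" for s
        unfolding F_def w_def using nz[OF that]
        by (intro integrable_continuous continuous_intros contPo h q qv c) auto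
      have c2: "continuous_on S (\<lambda>p. ?c (snd p))" for S :: "(complex \<times> real) set"
        by (rule continuous_on_compose2[OF c[of UNIV]]) (auto intro: continuous_intros)
      show "continuous_on (ball 0 \<rho> \<times> cbox 0 1) (\<lambda>(s, x). F' s x)"
        unfolding F'_def w_def case_prod_unfold using nz
        by (intro continuous_intros contPo h q qv h' q' qv' c2) auto
    qed simp
    moreover have "I h = (\<lambda>s. integral (cbox 0 1) (F s))"
      unfolding I_def F_def w_def contour_integral_integral vector_derivative_circlepath by simp
    ultimately show ?thesis by simp
  qed

  have "t = 0" if "t \<in> Z 0" for t
    using r(3)[of t] that by (auto simp: Z_def)
  then have Z0: "Z 0 = {0}" using r(1) P00 z0(1) by (auto simp: Z_def)
  have PZ: "Re (g (P s t)) < 0" if "cmod s < \<rho>" "t \<in> Z s" "s \<noteq> 0" for s t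
    using that by (intro neg P_ne d(2) \<rho>(3) r(2)) (auto simp: Z_def)
  define E where "E s = I g s / (2 * pi * \<i>)" for s
  have E: "E s = (\<Sum>t\<in>Z s. of_real (m s t) * g (P s t))" if "cmod s < \<rho>" for s
    using val[OF g that] by (simp add: E_def)
  have ReE: "Re (E s) = (\<Sum>t\<in>Z s. m s t * Re (g (P s t)))" if "cmod s < \<rho>" for s
    using E[OF that] by simp
  have E0: "E 0 = 0" using E[of 0] \<rho>(1) Z0 P00 z0(2) by simp
  have ReE_le: "Re (E s) \<le> 0" if s: "cmod s < \<rho>" for s
  proof (cases "s = 0")
    case False
    then show ?thesis
      unfolding ReE[OF s] using PZ[OF s] mpos[OF g s]
      by (intro sum_nonpos mult_nonneg_nonpos) (auto intro: less_imp_le)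
  qed (simp add: E0)
  have "(\<lambda>s. exp (E s)) constant_on ball 0 \<rho>"
  proof (rule maximum_modulus_principle[of _ _ "ball 0 \<rho>" 0])
    show "(\<lambda>s. exp (E s)) holomorphic_on ball 0 \<rho>"
      unfolding E_def by (intro holomorphic_intros hol g) auto
  qed (use \<rho>(1) ReE_le E0 in \<open>auto simp: norm_exp_eq_Re\<close>)
  then have "exp (E s) = exp (E 0)" if "cmod s < \<rho>" for s
    using that \<rho>(1) unfolding constant_on_def by (metis mem_ball_0 norm_zero)
  then have ReE0: "Re (E s) = 0" if "cmod s < \<rho>" for s
    using that E0 by (metis exp_zero norm_exp_eq_Re norm_one exp_eq_one_iff)
  have Z_empty: "Z s = {}" if s: "cmod s < \<rho>" "s \<noteq> 0" for s
  proof (rule ccontr)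
    assume "Z s \<noteq> {}"
    then have "0 < (\<Sum>t\<in>Z s. - (m s t * Re (g (P s t))))"
      using PZ[OF s(1)] s(2) mpos[OF g s(1)] by (intro sum_pos Zfin[OF g s(1)]) (auto intro: mult_pos_neg)
    then show False using ReE[OF s(1)] ReE0[OF s(1)] by (simp add: sum_negf)
  qed
  \<comment> \<open>The integral for the function 1 counts the points of the fibres.\<close>
  have one: "holo_poly (\<lambda>z :: complex^'n. 1)" by (rule holo_poly_const)
  have "isCont (I (\<lambda>_. 1)) 0"
    using holomorphic_on_imp_continuous_on[OF hol[OF one]] \<rho>(1)
    by (simp add: continuous_on_eq_continuous_at)
  then have "(I (\<lambda>_. 1) \<longlongrightarrow> I (\<lambda>_. 1) 0) (at 0)" by (simp add: isCont_def)
  moreover have "\<forall>\<^sub>F s in at 0. I (\<lambda>_. 1) s = 0"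
    unfolding eventually_at using \<rho>(1) val[OF one] Z_empty by (intro exI[of _ \<rho>]) auto
  then have "(I (\<lambda>_. 1) \<longlongrightarrow> 0) (at 0)" by (rule tendsto_eventually)
  ultimately have "I (\<lambda>_. 1) 0 = 0" using tendsto_unique trivial_limit_at by blast
  moreover have "I (\<lambda>_. 1) 0 = 2 * pi * \<i> * of_real (m 0 0)" using val[OF one, of 0] \<rho>(1) Z0 by simp
  moreover have "0 < m 0 0" using mpos[OF g, of 0 0] \<rho>(1) Z0 by simp
  ultimately show False by simp
qed

text \<open>If \<open>\<bar>p\<bar>\<close> were smaller on the zero set in the sphere than at \<open>0\<close>, then adding a small multiple of
  \<open>\<bar>z\<bar>\<^sup>2\<close> to the real part of \<open>p\<close>, suitably rotated, gives a function \<open>U\<close> that attains its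
  maximum over the zero set in the closed ball at an interior point \<open>z0\<close>. Expanding
  \<open>\<bar>z\<bar>\<^sup>2\<close> around \<open>z0\<close> gives \<open>U z - U z0 = Re (g z) + \<kappa> \<bar>z - z0\<bar>\<^sup>2\<close> with a holomorphic
  polynomial \<open>g\<close> vanishing at \<open>z0\<close>, so that \<open>Re g\<close> has a strict local maximum on the zero set.\<close>

lemma zero_set_maximum_principle:
  fixes p q :: "complex^'n \<Rightarrow> complex"
  assumes n: "2 \<le> CARD('n)" and p: "holo_poly p" and q: "holo_poly q"
    and q0: "q 0 = 0" and y: "q y \<noteq> 0"
  shows "\<exists>z\<in>sphere 0 1. q z = 0 \<and> cmod (p 0) \<le> cmod (p z)"
proof (rule ccontr)
  assume "\<not> ?thesis"
  then have lt: "cmod (p z) < cmod (p 0)" if "z \<in> sphere 0 1" "q z = 0" for z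
    using that by (meson not_le)
  define \<gamma> where "\<gamma> = cnj (sgn (p 0))"
  have \<gamma>0: "\<gamma> * p 0 = of_real (cmod (p 0))"
    by (cases "p 0 = 0") (simp_all add: \<gamma>_def sgn_eq field_simps complex_norm_square[symmetric] power2_eq_square)
  have \<gamma>1: "Re (\<gamma> * p z) \<le> cmod (p z)" for z
  proof -
    have "cmod \<gamma> \<le> 1" by (simp add: \<gamma>_def norm_sgn)
    then have "cmod (\<gamma> * p z) \<le> 1 * cmod (p z)" unfolding norm_mult by (intro mult_right_mono) auto
    then show ?thesis using complex_Re_le_cmod[of "\<gamma> * p z"] by simp
  qed
  have cont: "continuous_on S p" "continuous_on S q" for S using p q by (simp_all add: holo_poly_continuous)
  have closed: "closed {z. q z = 0}" by (intro closed_Collect_eq cont continuous_intros)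
  obtain \<kappa> where \<kappa>: "\<kappa> > 0" "\<And>z. z \<in> sphere 0 1 \<Longrightarrow> q z = 0 \<Longrightarrow> cmod (p z) + \<kappa> < cmod (p 0)"
  proof (cases "sphere 0 1 \<inter> {z. q z = 0} = {}")
    case True
    then show thesis by (intro that[of 1]) (auto simp: disjoint_iff)
  next
    case False
    have "compact (sphere 0 1 \<inter> {z. q z = 0})" by (intro compact_Int_closed compact_sphere closed)
    moreover have "continuous_on (sphere 0 1 \<inter> {z. q z = 0}) (\<lambda>z. cmod (p z))"
      by (intro continuous_intros cont)
    ultimately obtain z1 where z1: "z1 \<in> sphere 0 1 \<inter> {z. q z = 0}"
      "\<forall>z\<in>sphere 0 1 \<inter> {z. q z = 0}. cmod (p z) \<le> cmod (p z1)"
      using continuous_attains_sup False by blast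
    have "cmod (p z1) < cmod (p 0)" using z1(1) by (intro lt) auto
    then have "cmod (p z) + (cmod (p 0) - cmod (p z1)) / 2 < cmod (p 0)" if "z \<in> sphere 0 1" "q z = 0" for z
      using bspec[OF z1(2), of z] that by (simp add: field_simps)
    then show thesis using that[of "(cmod (p 0) - cmod (p z1)) / 2"] \<open>cmod (p z1) < cmod (p 0)\<close> by simp
  qed
  define U where "U z = Re (\<gamma> * p z) + \<kappa> * (norm z)\<^sup>2" for z
  have "compact (cball 0 1 \<inter> {z. q z = 0})" by (intro compact_Int_closed compact_cball closed)
  moreover have "continuous_on (cball 0 1 \<inter> {z. q z = 0}) U"
    unfolding U_def by (intro continuous_intros cont)
  moreover have "0 \<in> cball 0 1 \<inter> {z. q z = 0}" using q0 by simp
  ultimately obtain z0 where z0: "z0 \<in> cball 0 1" "q z0 = 0"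
    and max: "\<And>z. z \<in> cball 0 1 \<Longrightarrow> q z = 0 \<Longrightarrow> U z \<le> U z0"
    using continuous_attains_sup[of "cball 0 1 \<inter> {z. q z = 0}" U] by blast
  have "z0 \<notin> sphere 0 1"
  proof
    assume s: "z0 \<in> sphere 0 1"
    have "U z0 \<le> cmod (p z0) + \<kappa>" using s \<gamma>1[of z0] by (simp add: U_def)
    also have "\<dots> < U 0" using \<kappa>(2)[OF s z0(2)] \<gamma>0 by (simp add: U_def)
    finally show False using max[of 0] q0 by simp
  qed
  then have "norm z0 < 1" using z0(1) by simp
  define g where "g z = \<gamma> * (p z - p z0) + of_real (2 * \<kappa>) * (\<Sum>i\<in>UNIV. (z $ i - z0 $ i) * cnj (z0 $ i))" for z
  have "holo_poly g"
    unfolding g_def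
    by (intro holo_poly_add holo_poly_mult holo_poly_diff holo_poly_sum holo_poly_const holo_poly_coord p) simp
  moreover have "g z0 = 0" by (simp add: g_def)
  ultimately obtain z where z: "z \<noteq> z0" "dist z z0 < 1 - norm z0" "q z = 0" "0 \<le> Re (g z)"
    using zero_set_no_strict_local_max[OF n q _ y z0(2), of g "1 - norm z0"] \<open>norm z0 < 1\<close> by auto
  have "norm z \<le> norm z0 + dist z z0" using norm_triangle_ineq[of z0 "z - z0"] by (simp add: dist_norm)
  then have "U z \<le> U z0" using z by (intro max) auto
  define S where "S = (\<Sum>i\<in>UNIV. (z $ i - z0 $ i) * cnj (z0 $ i))"
  have S: "Re S = (z - z0) \<bullet> z0"
    by (simp add: S_def inner_vec_def inner_complex_def)
  have "Re (g z) = Re (\<gamma> * p z) - Re (\<gamma> * p z0) + 2 * \<kappa> * Re S"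
    unfolding g_def S_def[symmetric] by (simp add: algebra_simps)
  then have "Re (g z) = U z - U z0 - \<kappa> * (norm (z - z0))\<^sup>2"
    unfolding U_def S power2_norm_eq_inner
    by (simp add: inner_diff_left inner_diff_right inner_commute algebra_simps)
  moreover have "0 < \<kappa> * (norm (z - z0))\<^sup>2" using \<kappa>(1) z(1) by simp
  ultimately show False using z(4) \<open>U z \<le> U z0\<close> by linarith
qed

section \<open>A subset of the sphere with approximate roots\<close>

text \<open>With \<open>h = (q + \<rho>b)/\<rho>\<close> one has \<open>q' = \<rho>\<^sup>N (h\<^sup>N - f)\<close> and \<open>q = \<rho>(h - b)\<close>. The bound
  \<open>\<bar>q'\<bar> \<le> \<rho>\<^sup>N \<eta>\<close> thus says exactly that \<open>h\<^sup>N\<close> is within \<open>\<eta>\<close> of \<open>f\<close>; it bounds \<open>h\<close> by a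
  constant \<open>B\<close> that does not depend on \<open>\<rho>\<close>, and a small \<open>\<rho>\<close> makes \<open>q\<close> small. At the point \<open>y\<close>,
  where \<open>q\<close> does not vanish, a small \<open>\<rho>\<close> makes \<open>h\<close> so large that \<open>h\<^sup>N \<noteq> f\<close>; this keeps \<open>q'\<close>
  from being the zero polynomial.\<close>

lemma adjoin_approximate_root:
  fixes q f :: "complex^'n \<Rightarrow> complex"
  assumes q: "holo_poly q" "q 0 = 0" "q y \<noteq> 0" and f: "holo_poly f"
    and "\<delta> > 0" "\<eta> > 0" "N > 0"
  shows "\<exists>q' \<delta>' h. holo_poly q' \<and> q' 0 = 0 \<and> (\<exists>y. q' y \<noteq> 0) \<and> \<delta>' > 0 \<and> holo_poly h \<and>
    (\<forall>z\<in>cball 0 1. cmod (q' z) \<le> \<delta>' \<longrightarrow> cmod (q z) \<le> \<delta> \<and> cmod (h z ^ N - f z) \<le> \<eta>)"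
proof -
  have "compact (f ` cball 0 1)"
    by (intro compact_continuous_image holo_poly_continuous f compact_cball)
  then have "bounded (f ` cball 0 1)" by (rule compact_imp_bounded)
  then obtain M where "\<forall>x\<in>f ` cball 0 1. cmod x \<le> M" unfolding bounded_iff by blast
  then have M: "cmod (f z) \<le> M" if "z \<in> cball 0 1" for z using that by blast
  have "0 \<le> M" using M[of 0] order_trans[OF norm_ge_zero] by auto
  obtain b where b: "f 0 = b ^ N" using exists_complex_root[of N] \<open>N > 0\<close> by blast
  define B where "B = 1 + M + \<eta>"
  have "1 \<le> B" using \<open>0 \<le> M\<close> \<open>\<eta> > 0\<close> by (simp add: B_def)
  \<comment> \<open>The first bound gives \<open>\<bar>q\<bar> \<le> \<delta>\<close>, the second one \<open>q' y \<noteq> 0\<close>.\<close>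
  define \<rho> where "\<rho> = min (\<delta> / (B + cmod b)) (cmod (q y) / (1 + cmod (f y) + cmod b))"
  have pos: "0 < B + cmod b" "0 < 1 + cmod (f y) + cmod b"
    using \<open>1 \<le> B\<close> by (auto simp: add_pos_nonneg)
  then have "\<rho> > 0" using \<open>\<delta> > 0\<close> q(3) by (simp add: \<rho>_def)
  have "\<rho> \<le> \<delta> / (B + cmod b)" "\<rho> \<le> cmod (q y) / (1 + cmod (f y) + cmod b)" by (auto simp: \<rho>_def)
  then have \<rho>: "\<rho> * (B + cmod b) \<le> \<delta>" "\<rho> * (1 + cmod (f y) + cmod b) \<le> cmod (q y)"
    using pos by (simp_all add: pos_le_divide_eq)
  define h where "h z = (q z + \<rho> * b) * of_real (1 / \<rho>)" for z
  define q' where "q' z = (q z + \<rho> * b) ^ N - of_real (\<rho> ^ N) * f z" for z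
  have qh: "q z = \<rho> * h z - \<rho> * b" for z using \<open>\<rho> > 0\<close> by (simp add: h_def)
  have q'h: "q' z = of_real (\<rho> ^ N) * (h z ^ N - f z)" for z
    using \<open>\<rho> > 0\<close> by (simp add: q'_def qh power_mult_distrib algebra_simps)
  have "holo_poly h" unfolding h_def by (intro holo_poly_mult holo_poly_add holo_poly_const q)
  moreover have "holo_poly q'"
    unfolding q'_def by (intro holo_poly_diff holo_poly_power holo_poly_mult holo_poly_add holo_poly_const q f)
  moreover have "q' 0 = 0" by (simp add: q'_def q(2) b power_mult_distrib)
  moreover have "q' y \<noteq> 0"
  proof
    assume "q' y = 0"
    then have "h y ^ N = f y" using \<open>\<rho> > 0\<close> by (simp add: q'h)
    have "\<rho> * (1 + cmod (f y) + cmod b) \<le> cmod (q y)" by (rule \<rho>(2))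
    also have "\<dots> \<le> \<rho> * cmod (h y) + \<rho> * cmod b"
      unfolding qh[of y] using norm_triangle_ineq4[of "\<rho> * h y" "\<rho> * b"] \<open>\<rho> > 0\<close> by (simp add: norm_mult)
    finally have "\<rho> * (1 + cmod (f y)) \<le> \<rho> * cmod (h y)" by (simp add: algebra_simps)
    then have "1 + cmod (f y) \<le> cmod (h y)" using \<open>\<rho> > 0\<close> by simp
    moreover have "cmod (h y) \<le> cmod (h y) ^ N"
      using calculation \<open>N > 0\<close> by (intro self_le_power) (auto intro: order_trans[rotated])
    ultimately show False using \<open>h y ^ N = f y\<close> by (simp add: norm_power[symmetric])
  qed
  moreover have bound: "cmod (q z) \<le> \<delta> \<and> cmod (h z ^ N - f z) \<le> \<eta>"
    if z: "z \<in> cball 0 1" "cmod (q' z) \<le> \<rho> ^ N * \<eta>" for z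
  proof
    show "cmod (h z ^ N - f z) \<le> \<eta>" using z(2) \<open>\<rho> > 0\<close> by (simp add: q'h norm_mult norm_power)
    then have hB: "cmod (h z) ^ N \<le> B"
      using norm_triangle_ineq[of "h z ^ N - f z" "f z"] M[OF z(1)] by (simp add: B_def norm_power)
    have "cmod (h z) \<le> B"
    proof (cases "cmod (h z) \<le> 1")
      case False
      then show ?thesis using hB self_le_power[of "cmod (h z)" N] \<open>N > 0\<close> by simp
    qed (use \<open>1 \<le> B\<close> in simp)
    have "cmod (q z) \<le> \<rho> * cmod (h z) + \<rho> * cmod b"
      unfolding qh[of z] using norm_triangle_ineq4[of "\<rho> * h z" "\<rho> * b"] \<open>\<rho> > 0\<close> by (simp add: norm_mult)
    also have "\<dots> \<le> \<rho> * (B + cmod b)" using \<open>cmod (h z) \<le> B\<close> \<open>\<rho> > 0\<close> by (simp add: distrib_left)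
    finally show "cmod (q z) \<le> \<delta>" using \<rho>(1) by linarith
  qed
  moreover have "0 < \<rho> ^ N * \<eta>" using \<open>\<rho> > 0\<close> \<open>\<eta> > 0\<close> by simp
  ultimately show ?thesis
    using bound by (intro exI[of _ q'] exI[of _ "\<rho> ^ N * \<eta>"] exI[of _ h] conjI ballI impI exI[of _ y]) simp_all
qed

text \<open>A countable family of roots is adjoined one after the other. The sets \<open>X k\<close> on which the first
  \<open>k\<close> roots exist decrease, and by the maximum principle every polynomial \<open>p\<close> attains on each of
  them a value of modulus at least \<open>\<bar>p(0)\<bar>\<close>. The points where this happens form a decreasing
  sequence \<open>K k\<close> of nonempty compact sets; a common point shows that \<open>0\<close> is in the hull of the
  intersection.\<close>

lemma exists_hull_with_approximate_roots:
  fixes f :: "nat \<Rightarrow> complex^'n \<Rightarrow> complex" and N :: "nat \<Rightarrow> nat" and \<eta> :: "nat \<Rightarrow> real"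
  assumes n: "2 \<le> CARD('n)" and f: "\<And>k. holo_poly (f k)" and "\<And>k. N k > 0" "\<And>k. \<eta> k > 0"
  shows "\<exists>X. compact X \<and> X \<subseteq> sphere 0 1 \<and> 0 \<in> poly_hull X \<and>
    (\<forall>k. \<exists>h. holo_poly h \<and> (\<forall>x\<in>X. cmod (h x ^ N k - f k x) \<le> \<eta> k))"
proof -
  \<comment> \<open>The state consists of \<open>q\<close> and \<open>\<delta>\<close>, standing for the set \<open>\<bar>q\<bar> \<le> \<delta>\<close>.\<close>
  define Inv :: "(complex^'n \<Rightarrow> complex) \<times> real \<Rightarrow> bool"
    where "Inv s \<longleftrightarrow> holo_poly (fst s) \<and> fst s 0 = 0 \<and> (\<exists>y. fst s y \<noteq> 0) \<and> snd s > 0" for s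
  define Next where "Next k s s' \<longleftrightarrow> (\<exists>h. holo_poly h \<and>
      (\<forall>z\<in>cball 0 1. cmod (fst s' z) \<le> snd s' \<longrightarrow>
        cmod (fst s z) \<le> snd s \<and> cmod (h z ^ N k - f k z) \<le> \<eta> k))"
    for k and s s' :: "(complex^'n \<Rightarrow> complex) \<times> real"
  have "\<exists>s. \<forall>k. Inv (s k) \<and> Next k (s k) (s (Suc k))"
  proof (rule dependent_nat_choice)
    have "Inv (\<lambda>z. z $ i, 1)" for i
      unfolding Inv_def by (auto intro: holo_poly_coord exI[of _ "axis i 1"] simp: axis_def)
    then show "\<exists>s. Inv s" by blast
    fix s k assume "Inv s"
    then obtain y where "holo_poly (fst s)" "fst s 0 = 0" "fst s y \<noteq> 0" "snd s > 0"
      unfolding Inv_def by blast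
    then obtain q' \<delta>' h where "holo_poly q'" "q' 0 = 0" "\<exists>y. q' y \<noteq> 0" "\<delta>' > 0" "holo_poly h"
      "\<forall>z\<in>cball 0 1. cmod (q' z) \<le> \<delta>' \<longrightarrow> cmod (fst s z) \<le> snd s \<and> cmod (h z ^ N k - f k z) \<le> \<eta> k"
      using adjoin_approximate_root[of "fst s" y "f k" "snd s" "\<eta> k" "N k"] assms by auto
    then show "\<exists>s'. Inv s' \<and> Next k s s'"
      unfolding Inv_def Next_def by (intro exI[of _ "(q', \<delta>')"]) auto
  qed
  then obtain s where s: "\<And>k. Inv (s k)" "\<And>k. Next k (s k) (s (Suc k))" by blast
  define X where "X k = {z \<in> sphere 0 1. cmod (fst (s k) z) \<le> snd (s k)}" for k
  have "holo_poly (fst (s k))" for k using s(1) by (simp add: Inv_def)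
  then have X_closed: "closed (X k)" for k
    unfolding X_def sphere_def Collect_conj_eq[symmetric] mem_Collect_eq
    by (intro closed_Collect_conj closed_Collect_le closed_Collect_eq continuous_intros holo_poly_continuous)
  have X_bounded: "bounded (X k)" for k
    by (rule bounded_subset[OF bounded_sphere[of 0 1]]) (auto simp: X_def)
  have X_Suc: "X (Suc k) \<subseteq> X k" for k
    using s(2)[of k] unfolding X_def Next_def by fastforce
  have dec: "X k \<subseteq> X m" if "m \<le> k" for k m
    using lift_Suc_antimono_le[of X] X_Suc that by blast
  show ?thesis
  proof (intro exI[of _ "\<Inter>k. X k"] conjI allI)
    show "compact (\<Inter>k. X k)"
      unfolding compact_eq_bounded_closed
      using X_closed X_bounded[of 0] by (auto intro: bounded_subset)
    show "(\<Inter>k. X k) \<subseteq> sphere 0 1" by (auto simp: X_def)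
    show "\<exists>h. holo_poly h \<and> (\<forall>x\<in>\<Inter>k. X k. cmod (h x ^ N k - f k x) \<le> \<eta> k)" for k
    proof -
      obtain h where h: "holo_poly h"
        "\<And>z. z \<in> cball 0 1 \<Longrightarrow> cmod (fst (s (Suc k)) z) \<le> snd (s (Suc k)) \<Longrightarrow> cmod (h z ^ N k - f k z) \<le> \<eta> k"
        using s(2)[of k] unfolding Next_def by blast
      have "cmod (h x ^ N k - f k x) \<le> \<eta> k" if "x \<in> (\<Inter>k. X k)" for x
      proof (rule h(2))
        have "x \<in> X (Suc k)" using that by blast
        then show "x \<in> cball 0 1" "cmod (fst (s (Suc k)) x) \<le> snd (s (Suc k))" by (auto simp: X_def)
      qed
      then show ?thesis using h(1) by blast
    qed
    show "0 \<in> poly_hull (\<Inter>k. X k)"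
      unfolding poly_hull_def
    proof (intro CollectI allI impI)
      fix p :: "complex^'n \<Rightarrow> complex" assume p: "holo_poly p"
      define K where "K k = X k \<inter> {z. cmod (p 0) \<le> cmod (p z)}" for k
      have "(\<Inter>k. K k) \<noteq> {}"
      proof (rule compact_nest)
        fix k
        show "compact (K k)"
          unfolding K_def using X_closed X_bounded p
          by (intro compact_Int_closed closed_Collect_le continuous_intros holo_poly_continuous)
            (auto simp: compact_eq_bounded_closed)
        obtain y where q: "holo_poly (fst (s k))" "fst (s k) 0 = 0" "fst (s k) y \<noteq> 0" "snd (s k) > 0"
          using s(1)[of k] unfolding Inv_def by blast
        then show "K k \<noteq> {}"
          using zero_set_maximum_principle[OF n p q(1,2,3)] by (fastforce simp: K_def X_def)
      next
        show "K k \<subseteq> K m" if "m \<le> k" for m k using dec[OF that] by (auto simp: K_def)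
      qed
      then obtain x where x: "x \<in> (\<Inter>k. X k)" "cmod (p 0) \<le> cmod (p x)" by (auto simp: K_def)
      have "cmod (p x) \<le> sup_norm (\<Inter>k. X k) p"
        by (intro sup_norm_upper \<open>compact (\<Inter>k. X k)\<close> holo_poly_continuous p x)
      then show "cmod (p 0) \<le> sup_norm (\<Inter>k. X k) p" using x(2) by linarith
    qed
  qed
qed

text \<open>Approximate roots of \<open>z\<^sub>i - a\<close> for \<open>a\<close> in a countable dense set are approximate roots for all
  \<open>a\<close>, so countably many conditions suffice.\<close>

lemma exists_hull_with_coordinate_roots:
  assumes n: "2 \<le> CARD('n)"
  shows "\<exists>X :: (complex^'n) set. compact X \<and> X \<subseteq> sphere 0 1 \<and> 0 \<in> poly_hull X \<and>
    (\<forall>i a N \<eta>. N > 0 \<longrightarrow> \<eta> > 0 \<longrightarrow>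
      (\<exists>h. holo_poly h \<and> (\<forall>x\<in>X. cmod (h x ^ N - (x $ i - a)) \<le> \<eta>)))"
proof -
  obtain D :: "complex set" where D: "countable D" "\<And>U. open U \<Longrightarrow> U \<noteq> {} \<Longrightarrow> \<exists>d\<in>D. d \<in> U"
    using countable_dense_exists by metis
  then have "D \<noteq> {}" using open_UNIV by blast
  define d where "d = from_nat_into D"
  define code :: "nat \<Rightarrow> 'n \<times> nat \<times> nat \<times> nat" where "code = from_nat"
  define f :: "nat \<Rightarrow> complex^'n \<Rightarrow> complex" where "f k = (\<lambda>z. z $ fst (code k) - d (fst (snd (code k))))" for k
  define N where "N k = Suc (fst (snd (snd (code k))))" for k
  define \<eta> where "\<eta> k = 1 / real (Suc (snd (snd (snd (code k)))))" for k
  have "\<exists>X. compact X \<and> X \<subseteq> sphere 0 1 \<and> 0 \<in> poly_hull X \<and>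
    (\<forall>k. \<exists>h. holo_poly h \<and> (\<forall>x\<in>X. cmod (h x ^ N k - f k x) \<le> \<eta> k))"
    by (rule exists_hull_with_approximate_roots[OF n])
      (auto simp: f_def N_def \<eta>_def intro!: holo_poly_diff holo_poly_coord holo_poly_const)
  then obtain X where X: "compact X" "X \<subseteq> sphere 0 1" "0 \<in> poly_hull X"
    and roots: "\<And>k. \<exists>h. holo_poly h \<and> (\<forall>x\<in>X. cmod (h x ^ N k - f k x) \<le> \<eta> k)" by blast
  have "\<exists>h. holo_poly h \<and> (\<forall>x\<in>X. cmod (h x ^ N' - (x $ i - a)) \<le> e)" if "N' > 0" "e > 0" for i a N' e
  proof -
    obtain a' where "a' \<in> D" "a' \<in> ball a (e / 2)" using D(2)[of "ball a (e / 2)"] \<open>e > 0\<close> by auto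
    moreover obtain m where "d m = a'"
      using from_nat_into_surj[OF D(1) \<open>a' \<in> D\<close>] by (auto simp: d_def)
    moreover obtain l where l: "1 / real (Suc l) < e / 2"
      using nat_approx_posE[of "e / 2"] \<open>e > 0\<close> by auto
    obtain k where k: "code k = (i, m, N' - 1, l)" unfolding code_def by (metis from_nat_to_nat)
    ultimately have fk: "f k = (\<lambda>z. z $ i - a')" "cmod (a - a') < e / 2" "N k = N'" "\<eta> k < e / 2"
      using \<open>N' > 0\<close> l by (simp_all add: f_def N_def \<eta>_def dist_norm)
    obtain h where h: "holo_poly h" "\<forall>x\<in>X. cmod (h x ^ N k - f k x) \<le> \<eta> k" using roots by blast
    have "cmod (h x ^ N' - (x $ i - a)) \<le> e" if "x \<in> X" for x
    proof -
      have "h x ^ N' - (x $ i - a) = (h x ^ N k - f k x) + (a - a')" by (simp add: fk)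
      also have "cmod \<dots> \<le> \<eta> k + cmod (a - a')" using h(2) that by (intro norm_triangle_mono) auto
      finally show ?thesis using fk by linarith
    qed
    then show ?thesis using h(1) by blast
  qed
  then show ?thesis using X by blast
qed

section \<open>Separating the origin from the other points of the hull\<close>

text \<open>The Moebius transformation \<open>\<zeta> \<mapsto> (\<zeta> - \<alpha>) / (1 - \<alpha>\<zeta>)\<close> has the Taylor series
  \<open>-\<alpha> + (1 - \<alpha>\<^sup>2) \<zeta> (\<Sum>n. (\<alpha>\<zeta>)\<^sup>n)\<close>; cutting it off after \<open>M\<close> terms of the geometric series costs
  at most \<open>2\<alpha>\<^sup>M\<close> on the closed disc.\<close>

lemma truncated_Moebius_bound:
  fixes \<zeta> :: complex and \<alpha> :: real
  assumes \<alpha>: "0 < \<alpha>" "\<alpha> < 1" and \<zeta>: "cmod \<zeta> \<le> 1"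
  shows "cmod (- of_real \<alpha> + (1 - of_real (\<alpha>\<^sup>2)) * (\<zeta> * (\<Sum>n<M. (of_real \<alpha> * \<zeta>) ^ n))) \<le> 1 + 2 * \<alpha> ^ M"
proof -
  define x where "x = of_real \<alpha> * \<zeta>"
  have x: "cmod x \<le> \<alpha>" using \<alpha> \<zeta> mult_left_mono[of "cmod \<zeta>" 1 \<alpha>] by (simp add: x_def norm_mult)
  then have lower: "1 - \<alpha> \<le> cmod (1 - x)" using norm_triangle_ineq2[of 1 x] by simp
  then have "x \<noteq> 1" using \<alpha> by auto
  define T where "T = (\<Sum>n<M. x ^ n)"
  have "(- of_real \<alpha> + (1 - of_real (\<alpha>\<^sup>2)) * (\<zeta> * T)) * (1 - x) =
      - of_real \<alpha> * (1 - x) + (1 - of_real (\<alpha>\<^sup>2)) * (\<zeta> * ((1 - x) * T))"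
    by (simp add: algebra_simps)
  also have "(1 - x) * T = 1 - x ^ M" unfolding T_def by (rule one_diff_power_eq[symmetric])
  also have "- of_real \<alpha> * (1 - x) + (1 - of_real (\<alpha>\<^sup>2)) * (\<zeta> * (1 - x ^ M)) =
      \<zeta> - of_real \<alpha> - of_real (1 - \<alpha>\<^sup>2) * \<zeta> * x ^ M"
    by (simp add: algebra_simps power2_eq_square) (simp add: x_def algebra_simps)
  finally have "- of_real \<alpha> + (1 - of_real (\<alpha>\<^sup>2)) * (\<zeta> * T) =
      (\<zeta> - of_real \<alpha>) / (1 - x) - of_real (1 - \<alpha>\<^sup>2) * \<zeta> * x ^ M / (1 - x)"
    using \<open>x \<noteq> 1\<close> by (simp add: nonzero_eq_divide_eq diff_divide_distrib[symmetric])
  also have "cmod \<dots> \<le> cmod ((\<zeta> - of_real \<alpha>) / (1 - x)) + cmod (of_real (1 - \<alpha>\<^sup>2) * \<zeta> * x ^ M / (1 - x))"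
    by (rule norm_triangle_ineq4)
  also have "\<dots> \<le> 1 + 2 * \<alpha> ^ M"
  proof (rule add_mono)
    have "(cmod (\<zeta> - of_real \<alpha>))\<^sup>2 \<le> (cmod (1 - x))\<^sup>2"
    proof -
      have "(cmod (1 - x))\<^sup>2 - (cmod (\<zeta> - of_real \<alpha>))\<^sup>2 = (1 - \<alpha>\<^sup>2) * (1 - (cmod \<zeta>)\<^sup>2)"
        unfolding cmod_power2 x_def by (simp add: power2_eq_square algebra_simps)
      moreover have "0 \<le> (1 - \<alpha>\<^sup>2) * (1 - (cmod \<zeta>)\<^sup>2)"
        using \<alpha> \<zeta> by (intro mult_nonneg_nonneg) (simp_all add: power_le_one)
      ultimately show ?thesis by linarith
    qed
    then have "cmod (\<zeta> - of_real \<alpha>) \<le> cmod (1 - x)" by (rule power2_le_imp_le) simp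
    then show "cmod ((\<zeta> - of_real \<alpha>) / (1 - x)) \<le> 1"
      using \<open>x \<noteq> 1\<close> by (simp add: norm_divide)
    have "0 \<le> 1 - \<alpha>\<^sup>2" using \<alpha> by (simp add: power_le_one)
    have "cmod (of_real (1 - \<alpha>\<^sup>2) * \<zeta> * x ^ M / (1 - x)) = (1 - \<alpha>\<^sup>2) * cmod \<zeta> * cmod x ^ M / cmod (1 - x)"
      using \<open>0 \<le> 1 - \<alpha>\<^sup>2\<close> by (simp only: norm_divide norm_mult norm_power norm_of_real abs_of_nonneg)
    also have "\<dots> \<le> (1 - \<alpha>\<^sup>2) * 1 * \<alpha> ^ M / (1 - \<alpha>)"
      using \<open>0 \<le> 1 - \<alpha>\<^sup>2\<close> \<alpha> \<zeta> x lower by (intro frac_le mult_mono power_mono) auto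
    also have "\<dots> = (1 + \<alpha>) * \<alpha> ^ M" using \<alpha> by (simp add: field_simps power2_eq_square)
    also have "\<dots> \<le> 2 * \<alpha> ^ M" using \<alpha> by (intro mult_right_mono) auto
    finally show "cmod (of_real (1 - \<alpha>\<^sup>2) * \<zeta> * x ^ M / (1 - x)) \<le> 2 * \<alpha> ^ M" .
  qed
  finally show ?thesis unfolding T_def x_def .
qed

text \<open>The Moebius transformation above takes the values \<open>-\<alpha>\<close> at 0 and 1 at 1. With \<open>\<alpha>\<close> close to 1, a
  Taylor polynomial of high degree, divided by its bound, has values at 0 and 1 almost 2 apart.\<close>

lemma disc_poly_separating_0_1:
  assumes "\<epsilon> > 0"
  obtains \<Phi> :: "complex poly" where "\<And>\<zeta>. cmod \<zeta> \<le> 1 \<Longrightarrow> cmod (poly \<Phi> \<zeta>) \<le> 1"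
    "cmod (poly \<Phi> 1 - poly \<Phi> 0) > 2 - \<epsilon>"
proof -
  define \<alpha> where "\<alpha> = max (1/2) (1 - \<epsilon> / 2)"
  have \<alpha>: "0 < \<alpha>" "\<alpha> < 1" "1 + \<alpha> > 2 - \<epsilon>" using assms by (auto simp: \<alpha>_def)
  have "(\<lambda>M. (1 + \<alpha>) * (1 - \<alpha> ^ M) / (1 + 2 * \<alpha> ^ M)) \<longlonglongrightarrow> (1 + \<alpha>) * (1 - 0) / (1 + 2 * 0)"
    using \<alpha> by (intro tendsto_intros LIMSEQ_realpow_zero) auto
  then have "\<forall>\<^sub>F M in sequentially. 2 - \<epsilon> < (1 + \<alpha>) * (1 - \<alpha> ^ M) / (1 + 2 * \<alpha> ^ M)"
    using \<alpha>(3) by (intro order_tendstoD(1)) auto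
  then obtain M where M: "2 - \<epsilon> < (1 + \<alpha>) * (1 - \<alpha> ^ M) / (1 + 2 * \<alpha> ^ M)"
    by (auto simp: eventually_sequentially)
  define \<Psi> :: "complex poly" where
    "\<Psi> = [:- of_real \<alpha>:] + smult (1 - of_real (\<alpha>\<^sup>2)) (\<Sum>n<M. monom (of_real (\<alpha> ^ n)) (Suc n))"
  have \<Psi>: "poly \<Psi> \<zeta> = - of_real \<alpha> + (1 - of_real (\<alpha>\<^sup>2)) * (\<zeta> * (\<Sum>n<M. (of_real \<alpha> * \<zeta>) ^ n))" for \<zeta>
    by (simp add: \<Psi>_def poly_sum poly_monom sum_distrib_left power_mult_distrib mult_ac)
  define c where "c = 1 + 2 * \<alpha> ^ M"
  have "c > 0" using \<alpha> by (simp add: c_def add_pos_pos)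
  have c1: "cmod (complex_of_real (1 / c)) = 1 / c" using \<open>c > 0\<close> by (simp only: norm_of_real) simp
  show thesis
  proof (rule that[of "smult (of_real (1 / c)) \<Psi>"])
    show "cmod (poly (smult (of_real (1 / c)) \<Psi>) \<zeta>) \<le> 1" if "cmod \<zeta> \<le> 1" for \<zeta>
      using truncated_Moebius_bound[OF \<alpha>(1,2) that, of M] \<open>c > 0\<close>
      unfolding poly_smult norm_mult c1 \<Psi> c_def[symmetric] by (simp add: pos_divide_le_eq)
    have "poly \<Psi> 1 - poly \<Psi> 0 = of_real ((1 - \<alpha>\<^sup>2) * (\<Sum>n<M. \<alpha> ^ n))" unfolding \<Psi> by simp
    also have "(1 - \<alpha>\<^sup>2) * (\<Sum>n<M. \<alpha> ^ n) = (1 + \<alpha>) * (1 - \<alpha> ^ M)"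
      using \<alpha> by (simp add: sum_gp_strict field_simps power2_eq_square)
    finally have "cmod (poly (smult (of_real (1 / c)) \<Psi>) 1 - poly (smult (of_real (1 / c)) \<Psi>) 0) =
        1 / c * \<bar>(1 + \<alpha>) * (1 - \<alpha> ^ M)\<bar>"
      unfolding poly_smult right_diff_distrib[symmetric] norm_mult c1 by (simp only: norm_of_real)
    also have "\<dots> \<ge> (1 + \<alpha>) * (1 - \<alpha> ^ M) / (1 + 2 * \<alpha> ^ M)"
      using \<open>c > 0\<close> abs_ge_self[of "(1 + \<alpha>) * (1 - \<alpha> ^ M)"] unfolding c_def[symmetric]
      by (simp add: divide_right_mono)
    finally show "cmod (poly (smult (of_real (1 / c)) \<Psi>) 1 - poly (smult (of_real (1 / c)) \<Psi>) 0) > 2 - \<epsilon>"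
      using M by linarith
  qed
qed

text \<open>Let \<open>a = w\<^sub>i \<noteq> 0\<close>. Since \<open>\<bar>z\<^sub>i - a\<bar> + \<eta> \<le> K\<close> on \<open>X\<close>, an approximate \<open>N\<close>-th root \<open>h\<close> of
  \<open>z\<^sub>i - a\<close>, divided by the \<open>N\<close>-th root of \<open>K\<close>, is bounded by 1 on \<open>X\<close>. At the origin the \<open>N\<close>-th
  power of this quotient has modulus at least \<open>\<bar>a\<bar>/(2K)\<close>, so the quotient is nearly unimodular
  when \<open>N\<close> is large; at \<open>w\<close> the power is at most \<open>\<eta>\<close>, which may be taken smaller than \<open>d\<^sup>N\<close>. After
  a rotation the values at \<open>0\<close> and \<open>w\<close> are near 1 and 0, where the polynomial \<open>\<Phi>\<close> separates them.\<close>

lemma approximate_roots_separate: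
  fixes X :: "(complex^'n) set"
  assumes X: "X \<subseteq> sphere 0 1" and hull: "0 \<in> poly_hull X" "w \<in> poly_hull X" and "w \<noteq> 0" and "\<epsilon> > 0"
    and roots: "\<And>i a N \<eta>. N > 0 \<Longrightarrow> \<eta> > 0 \<Longrightarrow>
      \<exists>h. holo_poly h \<and> (\<forall>x\<in>X. cmod (h x ^ N - (x $ i - a)) \<le> \<eta>)"
  obtains p where "holo_poly p" "\<And>x. x \<in> X \<Longrightarrow> cmod (p x) \<le> 1" "cmod (p 0 - p w) > 2 - \<epsilon>"
proof -
  obtain \<Phi> :: "complex poly" where \<Phi>: "\<And>\<zeta>. cmod \<zeta> \<le> 1 \<Longrightarrow> cmod (poly \<Phi> \<zeta>) \<le> 1"
    "cmod (poly \<Phi> 1 - poly \<Phi> 0) > 2 - \<epsilon>"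
    using disc_poly_separating_0_1[OF \<open>\<epsilon> > 0\<close>] by blast
  obtain d where d: "0 < d" "d < 1"
    "\<And>\<zeta> \<xi>. cmod (\<zeta> - 1) < d \<Longrightarrow> cmod \<xi> < d \<Longrightarrow> cmod (poly \<Phi> \<zeta> - poly \<Phi> \<xi>) > 2 - \<epsilon>"
  proof -
    have "open {x. 2 - \<epsilon> < cmod (poly \<Phi> (fst x) - poly \<Phi> (snd x))}"
      by (intro open_Collect_less continuous_intros)
    moreover have "(1, 0) \<in> {x. 2 - \<epsilon> < cmod (poly \<Phi> (fst x) - poly \<Phi> (snd x))}" using \<Phi>(2) by simp
    ultimately obtain e where e: "e > 0" "ball (1, 0) e \<subseteq> {x. 2 - \<epsilon> < cmod (poly \<Phi> (fst x) - poly \<Phi> (snd x))}"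
      by (meson openE)
    have "cmod (poly \<Phi> \<zeta> - poly \<Phi> \<xi>) > 2 - \<epsilon>" if "cmod (\<zeta> - 1) < e / 2" "cmod \<xi> < e / 2" for \<zeta> \<xi>
    proof -
      have "norm (\<zeta> - 1, \<xi>) < e" using norm_Pair_le[of "\<zeta> - 1" \<xi>] that by linarith
      then have "(\<zeta>, \<xi>) \<in> ball (1, 0) e" by (simp add: dist_norm norm_Pair norm_minus_commute)
      from subsetD[OF e(2) this] show ?thesis by simp
    qed
    then show thesis using that[of "min (e / 2) (1 / 2)"] e(1) by simp
  qed
  obtain i where "w $ i \<noteq> 0" using \<open>w \<noteq> 0\<close> by (auto simp: vec_eq_iff)
  define a where "a = w $ i"
  have "a \<noteq> 0" using \<open>w $ i \<noteq> 0\<close> by (simp add: a_def)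
  define K where "K = 2 + cmod a"
  have "K \<ge> 2" by (simp add: K_def)
  have "\<forall>\<^sub>F N in sequentially. (1 - d) ^ N < cmod a / (2 * K)"
    using d \<open>a \<noteq> 0\<close> \<open>K \<ge> 2\<close> by (intro order_tendstoD(2)[OF LIMSEQ_realpow_zero]) auto
  then have "\<forall>\<^sub>F N in sequentially. (1 - d) ^ N < cmod a / (2 * K) \<and> 0 < N"
    using eventually_gt_at_top by (rule eventually_conj)
  then obtain N where N: "(1 - d) ^ N < cmod a / (2 * K)" "0 < N"
    by (auto simp: eventually_sequentially)
  define \<eta> where "\<eta> = min (min 1 (cmod a / 2)) (d ^ N)"
  have \<eta>: "\<eta> > 0" "\<eta> \<le> 1" "\<eta> \<le> cmod a / 2" "\<eta> \<le> d ^ N" using \<open>a \<noteq> 0\<close> d by (auto simp: \<eta>_def)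
  obtain h where h: "holo_poly h" "\<And>x. x \<in> X \<Longrightarrow> cmod (h x ^ N - (x $ i - a)) \<le> \<eta>"
    using roots[OF N(2) \<eta>(1)] by metis
  have "holo_poly (\<lambda>z. h z ^ N - (z $ i - a))"
    by (intro holo_poly_diff holo_poly_power holo_poly_coord holo_poly_const h)
  from poly_hull_le[OF hull(1) this h(2)] poly_hull_le[OF hull(2) this h(2)]
  have h0: "cmod (h 0 ^ N + a) \<le> \<eta>" and hw: "cmod (h w ^ N) \<le> \<eta>" by (simp_all add: a_def)
  define k where "k = root N K"
  have "k > 0" and kN: "k ^ N = K" using N(2) \<open>K \<ge> 2\<close> by (simp_all add: k_def)
  \<comment> \<open>The rotation that makes the value at the origin real and nonnegative.\<close>
  define s where "s = cnj (sgn (h 0))"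
  have s1: "cmod s \<le> 1" by (simp add: s_def norm_sgn)
  have s0: "s * h 0 = of_real (cmod (h 0))"
    by (cases "h 0 = 0") (simp_all add: s_def sgn_eq field_simps complex_norm_square[symmetric] power2_eq_square)
  define v where "v z = of_real (1 / k) * (s * h z)" for z
  have v_le: "cmod (v z) \<le> cmod (h z) / k" for z
    using mult_right_mono[OF s1, of "cmod (h z)"] \<open>k > 0\<close>
    by (simp add: v_def norm_mult norm_divide divide_right_mono)
  have "holo_poly v" unfolding v_def by (intro holo_poly_mult holo_poly_const h)
  have v1: "cmod (v x) \<le> 1" if "x \<in> X" for x
  proof -
    have "cmod (x $ i) \<le> 1" using that X Finite_Cartesian_Product.norm_nth_le[of x i] by auto
    moreover have "cmod (h x ^ N) \<le> cmod (h x ^ N - (x $ i - a)) + cmod (x $ i - a)"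
      using norm_triangle_ineq[of "h x ^ N - (x $ i - a)" "x $ i - a"] by simp
    ultimately have "cmod (h x) ^ N \<le> k ^ N"
      using h(2)[OF that] \<eta>(2) norm_triangle_ineq4[of "x $ i" a] unfolding kN K_def norm_power[symmetric] by linarith
    then have "cmod (h x) \<le> k" using \<open>k > 0\<close> N(2) by (simp add: power_mono_iff)
    then have "cmod (h x) / k \<le> 1" using \<open>k > 0\<close> by simp
    then show ?thesis using v_le[of x] by linarith
  qed
  have "cmod (v w) < d"
  proof -
    have "(cmod (h w) / k) ^ N < d ^ N"
    proof -
      have "(cmod (h w) / k) ^ N = cmod (h w ^ N) / K" by (simp add: power_divide kN norm_power)
      also have "\<dots> \<le> \<eta> / 2" using hw \<eta>(1) \<open>K \<ge> 2\<close> by (intro frac_le) auto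
      finally show ?thesis using \<eta>(1,4) by linarith
    qed
    then have "cmod (h w) / k < d" using d(1) by (rule power_less_imp_less_base[OF _ less_imp_le])
    then show ?thesis using v_le[of w] by linarith
  qed
  moreover have "cmod (v 0 - 1) < d"
  proof -
    have "v 0 = of_real (cmod (h 0) / k)" by (simp add: v_def s0)
    moreover then have "cmod (h 0) / k \<le> 1"
      using poly_hull_le[OF hull(1) \<open>holo_poly v\<close> v1] \<open>k > 0\<close>
      by (simp only: norm_of_real) (simp add: abs_of_nonneg)
    moreover have "1 - d < cmod (h 0) / k"
    proof -
      have "(1 - d) ^ N < cmod a / (2 * K)" by (rule N(1))
      also have "\<dots> \<le> cmod (h 0 ^ N) / K"
      proof -
        have "cmod a / 2 \<le> cmod (h 0 ^ N)"
          using h0 \<eta>(3) norm_triangle_ineq4[of "h 0 ^ N + a" "h 0 ^ N"] by simp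
        then have "cmod a / 2 / K \<le> cmod (h 0 ^ N) / K" using \<open>K \<ge> 2\<close> by (intro divide_right_mono) auto
        then show ?thesis by (simp add: divide_divide_eq_left)
      qed
      also have "\<dots> = (cmod (h 0) / k) ^ N" by (simp add: power_divide kN norm_power)
      finally show ?thesis by (rule power_less_imp_less_base) (use \<open>k > 0\<close> in simp)
    qed
    ultimately have "v 0 - 1 = of_real (cmod (h 0) / k - 1)" "\<bar>cmod (h 0) / k - 1\<bar> < d" by auto
    then show ?thesis by (simp only: norm_of_real)
  qed
  ultimately have "cmod (poly \<Phi> (v 0) - poly \<Phi> (v w)) > 2 - \<epsilon>" by (intro d(3))
  then show thesis
    using that[of "\<lambda>z. poly \<Phi> (v z)"] holo_poly_poly[OF \<open>holo_poly v\<close>] \<Phi>(1) v1 by blast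
qed

lemma dual_norm_eval_diff_ge:
  assumes X: "compact X" and z: "z \<in> poly_hull X" and w: "w \<in> poly_hull X"
    and p: "holo_poly p" "\<And>x. x \<in> X \<Longrightarrow> cmod (p x) \<le> 1"
  shows "cmod (p z - p w) \<le> dual_norm X (\<lambda>f. eval_functional X z f - eval_functional X w f)"
proof -
  have ne: "X \<noteq> {}" using z by (rule poly_hull_nonempty)
  let ?\<psi> = "\<lambda>f. cmod (eval_functional X z f - eval_functional X w f)"
  have "?\<psi> f \<le> 2" if "f \<in> {f \<in> P_alg X. sup_norm X f \<le> 1}" for f
  proof -
    have "cmod (eval_functional X z f) \<le> 1" "cmod (eval_functional X w f) \<le> 1"
      using that eval_functional_norm_le[OF X z, of f] eval_functional_norm_le[OF X w, of f] by auto
    then show ?thesis using norm_triangle_ineq4[of "eval_functional X z f" "eval_functional X w f"] by linarith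
  qed
  then have "bdd_above (?\<psi> ` {f \<in> P_alg X. sup_norm X f \<le> 1})" by (rule bdd_aboveI2)
  moreover have "restrict p X \<in> {f \<in> P_alg X. sup_norm X f \<le> 1}"
    using poly_in_P_alg[OF X ne p(1)] sup_norm_least[OF ne, of "restrict p X" 1] p(2) by simp
  ultimately have "?\<psi> (restrict p X) \<le> dual_norm X (\<lambda>f. eval_functional X z f - eval_functional X w f)"
    unfolding dual_norm_def by (rule cSUP_upper[rotated])
  then show ?thesis by (simp only: eval_functional(2)[OF X z p(1)] eval_functional(2)[OF X w p(1)])
qed

theorem theorem1p1:
  shows "\<exists>X :: (complex^2) set. compact X \<and> X \<subseteq> frontier (ball 0 1) \<and>
           0 \<in> poly_hull X - X \<and> one_point_gleason_part X 0"
proof -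
  have "2 \<le> CARD(2)" by simp
  from exists_hull_with_coordinate_roots[OF this] obtain X :: "(complex^2) set"
    where X: "compact X" "X \<subseteq> sphere 0 1" "0 \<in> poly_hull X"
      and roots: "\<And>i a N \<eta>. N > 0 \<Longrightarrow> \<eta> > 0 \<Longrightarrow>
        \<exists>h. holo_poly h \<and> (\<forall>x\<in>X. cmod (h x ^ N - (x $ i - a)) \<le> \<eta>)" by blast
  have "one_point_gleason_part X 0"
    unfolding one_point_gleason_part_iff[OF X(1)]
  proof (intro conjI ballI X(3))
    fix w assume w: "w \<in> poly_hull X - {0}"
    let ?n = "dual_norm X (\<lambda>f. eval_functional X 0 f - eval_functional X w f)"
    have w_hull: "w \<in> poly_hull X" and w_ne: "w \<noteq> 0" using w by auto
    have "2 \<le> ?n + e" if e: "e > 0" for e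
    proof -
      obtain p where p: "holo_poly p" "\<And>x. x \<in> X \<Longrightarrow> cmod (p x) \<le> 1" "cmod (p 0 - p w) > 2 - e"
        using approximate_roots_separate[OF X(2,3) w_hull w_ne e roots] by blast
      then show ?thesis using dual_norm_eval_diff_ge[OF X(1,3) w_hull p(1,2)] by linarith
    qed
    then have "2 \<le> ?n" by (rule field_le_epsilon)
    then show "?n = 2" using dual_norm_eval_diff_le[OF X(1,3) w_hull] by linarith
  qed
  moreover have "0 \<notin> X" using X(2) by auto
  ultimately show ?thesis using X by (intro exI[of _ X]) auto
qed

end
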